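(* Let $AF_D$ be the set of aromatic forests decorated by a set $D$ (or the set of grafted forests, or the set of exotic forests), $\mathcal{AF}_D$ its span, and let $F_f$ be a linear map from $\mathcal{AF}_D$ to differential operators on $\mathbb{R}^d$ satisfying $F_f(\pi_1\diamond\pi_2)[\cdot]=F_f(\pi_1)\big[F_f(\pi_2)[\cdot]\big]$ for all $\pi_1,\pi_2\in\mathcal{AF}_D$, where $\diamond$ is the Grossman–Larson product. For a linear functional $a\in\mathcal{AF}_D^*$ define the S-series $$S(a)=\sum_{\pi\in AF_D}\frac{a(\pi)}{\sigma(\pi)}F_f(\pi).$$ Then for any two S-series $S(a),S(b)$ and any test function $\phi$, $$S(a)\big[S(b)[\phi]\big]=S(a*b)[\phi],\qquad a*b=m_{\mathbb{R}}\circ(a\otimes b)\circ\Delta_{CK},$$ where $\Delta_{CK}$ is the Connes–Kreimer coproduct on $\mathcal{AF}_D$ and $m_{\mathbb{R}}$ is multiplication in $\mathbb{R}$.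
   Context: **Aromatic forests.** An aromatic forest is a finite directed graph (self-loops allowed), up to isomorphism, in which every vertex has at most one outgoing edge, and which is either empty or has at least one root (vertex without outgoing edge). $AF$ denotes the set of aromatic forests. For a set $D$, $AF_D$ is the set of isomorphism classes of pairs $(\pi,\alpha)$, $\pi\in AF$, $\alpha:V(\pi)\to D$; an isomorphism $(\pi_1,\alpha_1)\to(\pi_2,\alpha_2)$ is a graph isomorphism $\varphi$ with $\alpha_1=\alpha_2\circ\varphi$. $\sigma(\pi)$ is the number of automorphisms. $\mathcal{AF}_D$ is the real vector space with basis $AF_D$. **Grossman–Larson product.** $\pi_1\diamond\pi_2$ is the sum, over all maps from the set of roots of $\pi_1$ to $V(\pi_2)\sqcup\{\ast\}$, of the decorated forest obtained from the disjoint union of $\pi_1$ and $\pi_2$ by adding an edge from each root of $\pi_1$ to its image vertex (no edge if the image is $\ast$). **Connes–Kreimer coproduct.** $\Delta_{CK}(\pi,\alpha)=\sum_{\pi_0\subset\pi}(\pi\setminus\pi_0,\alpha|_{\pi\setminus\pi_0})\otimes(\pi_0,\alpha|_{\pi_0})$, the sum over all induced subgraphs $\pi_0$ on vertex subsets with $\pi_0\in AF$, $\pi\setminus\pi_0\in AF$, and no edge of $\pi$ going from $\pi_0$ to $\pi\setminus\pi_0$. **Grafted and exotic forests.** Grafted forests are forests decorated by $\{\bullet,\times\}$ in which $\times$-vertices have no incoming edges (attaching to a $\times$-vertex in $\diamond$ gives zero). Exotic forests are grafted forests with a perfect matching of the $\times$-vertices (isomorphisms preserve the matching); in $\diamond$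 the matchings are united, and in $\Delta_{CK}$ only those $\pi_0$ are used for which no matched pair is split between $\pi_0$ and $\pi\setminus\pi_0$. **Formal series.** S-series are formal series graded by the number of vertices: $S=F_f\circ\delta_\sigma$ with $\delta_\sigma(a)=\sum_{\pi}\frac{a(\pi)}{\sigma(\pi)}\pi$ an element of the completion of $\mathcal{AF}_D$ with respect to the number of vertices, and $F_f$ and $\diamond$ are extended termwise to formal sums. $S(a)[S(b)[\phi]]$ is the formal double series $\sum_{\pi_1,\pi_2}\frac{a(\pi_1)b(\pi_2)}{\sigma(\pi_1)\sigma(\pi_2)}F_f(\pi_1)[F_f(\pi_2)[\phi]]$, regrouped according to total number of vertices; the equality is one of formal series. A test function is a smooth $\phi:\mathbb{R}^d\to\mathbb{R}$ all of whose partial derivatives have polynomial growth. *)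

theory Defs
  imports
    "HOL-Analysis.Analysis"
    "HOL-Library.Poly_Mapping"
    "HOL-Library.Disjoint_Sets"
    "HOL-Library.Nat_Bijection"
    "HOL-Combinatorics.Permutations"
begin

section \<open>Aromatic, grafted and exotic forests\<close>

text \<open>One decoration type serves the three settings: \<open>Dec c\<close> for \<open>c \<in> D\<close>, and the bullet and the cross
  of grafted and exotic forests.\<close>

datatype 'c decoration = Dec 'c | Bullet | Cross

text \<open>A representative of a forest. The values of \<open>deco\<close> outside \<open>verts\<close> are irrelevant (isomorphisms
  ignore them). The field \<open>pairs\<close> holds the matched pairs of an exotic forest and is empty in the two
  other settings.\<close>

record 'c forest_graph =
  verts :: "nat set"
  edges :: "(nat \<times> nat) set"
  deco :: "nat \<Rightarrow> 'c decoration"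
  pairs :: "nat set set"

definition roots :: "'c forest_graph \<Rightarrow> nat set" where
  "roots G = {v \<in> verts G. \<forall>w. (v, w) \<notin> edges G}"

definition crosses :: "'c forest_graph \<Rightarrow> nat set" where
  "crosses G = {v \<in> verts G. deco G v = Cross}"

definition aromatic_graph :: "'c forest_graph \<Rightarrow> bool" where
  "aromatic_graph G \<longleftrightarrow>
     finite (verts G) \<and> edges G \<subseteq> verts G \<times> verts G \<and> single_valued (edges G) \<and>
     (verts G = {} \<or> roots G \<noteq> {}) \<and> \<Union> (pairs G) \<subseteq> verts G"

definition decorated_graph :: "'c set \<Rightarrow> 'c forest_graph \<Rightarrow> bool" where
  "decorated_graph D G \<longleftrightarrow> aromatic_graph G \<and> deco G ` verts G \<subseteq> Dec ` D \<and> pairs G = {}"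

definition cross_graph :: "'c forest_graph \<Rightarrow> bool" where
  "cross_graph G \<longleftrightarrow>
     aromatic_graph G \<and> deco G ` verts G \<subseteq> {Bullet, Cross} \<and> (\<forall>(u, v) \<in> edges G. deco G v \<noteq> Cross)"

definition grafted_graph :: "'c forest_graph \<Rightarrow> bool" where
  "grafted_graph G \<longleftrightarrow> cross_graph G \<and> pairs G = {}"

definition exotic_graph :: "'c forest_graph \<Rightarrow> bool" where
  "exotic_graph G \<longleftrightarrow>
     cross_graph G \<and> partition_on (crosses G) (pairs G) \<and> (\<forall>p \<in> pairs G. card p = 2)"

definition is_iso :: "(nat \<Rightarrow> nat) \<Rightarrow> 'c forest_graph \<Rightarrow> 'c forest_graph \<Rightarrow> bool" where
  "is_iso f G H \<longleftrightarrow>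
     bij_betw f (verts G) (verts H) \<and>
     (\<forall>u \<in> verts G. \<forall>v \<in> verts G. (u, v) \<in> edges G \<longleftrightarrow> (f u, f v) \<in> edges H) \<and>
     (\<forall>v \<in> verts G. deco G v = deco H (f v)) \<and>
     (\<lambda>p. f ` p) ` pairs G = pairs H"

definition iso_rel :: "('c forest_graph \<times> 'c forest_graph) set" where
  "iso_rel = {(G, H). aromatic_graph G \<and> aromatic_graph H \<and> (\<exists>f. is_iso f G H)}"

lemma equiv_iso_rel: "equiv {G. aromatic_graph G} iso_rel"
proof (rule equivI)
  show "iso_rel \<subseteq> {G. aromatic_graph G} \<times> {G. aromatic_graph G}"
    by (auto simp: iso_rel_def)
  show "refl_on {G. aromatic_graph G} iso_rel"
  proof (rule refl_onI)
    fix G :: "'c forest_graph" assume "G \<in> {G. aromatic_graph G}"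
    moreover have "is_iso id G G" by (auto simp: is_iso_def)
    ultimately show "(G, G) \<in> iso_rel" by (auto simp: iso_rel_def)
  qed
  show "sym iso_rel"
  proof (rule symI)
    fix G H :: "'c forest_graph" assume "(G, H) \<in> iso_rel"
    then obtain f where ar: "aromatic_graph G" "aromatic_graph H" and f: "is_iso f G H"
      by (auto simp: iso_rel_def)
    let ?g = "inv_into (verts G) f"
    have bij: "bij_betw f (verts G) (verts H)" using f by (simp add: is_iso_def)
    have g: "?g v \<in> verts G" "f (?g v) = v" if "v \<in> verts H" for v
      using that bij by (auto simp: bij_betw_def inv_into_into f_inv_into_f)
    have "?g ` f ` p = p" if "p \<in> pairs G" for p
    proof -
      have "p \<subseteq> verts G" using that ar by (auto simp: aromatic_graph_def)
      thus ?thesis using bij by (simp add: bij_betw_def inv_into_image_cancel)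
    qed
    hence "(\<lambda>p. ?g ` p) ` (\<lambda>p. f ` p) ` pairs G = pairs G" by (simp add: image_image)
    hence "is_iso ?g H G"
      using f g bij_betw_inv_into[OF bij] unfolding is_iso_def by auto
    thus "(H, G) \<in> iso_rel" using ar by (auto simp: iso_rel_def)
  qed
  show "trans iso_rel"
  proof (rule transI)
    fix G H K :: "'c forest_graph" assume "(G, H) \<in> iso_rel" "(H, K) \<in> iso_rel"
    then obtain f g where ar: "aromatic_graph G" "aromatic_graph K"
      and f: "is_iso f G H" and g: "is_iso g H K" by (auto simp: iso_rel_def)
    have "is_iso (g \<circ> f) G K"
      unfolding is_iso_def
    proof (intro conjI)
      show "bij_betw (g \<circ> f) (verts G) (verts K)"
        using f g by (auto simp: is_iso_def intro: bij_betw_trans)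
      have m: "f v \<in> verts H" if "v \<in> verts G" for v
        using f that by (auto simp: is_iso_def bij_betw_def)
      show "\<forall>u\<in>verts G. \<forall>v\<in>verts G. ((u, v) \<in> edges G) = (((g \<circ> f) u, (g \<circ> f) v) \<in> edges K)"
        using f g m by (auto simp: is_iso_def)
      show "\<forall>v\<in>verts G. deco G v = deco K ((g \<circ> f) v)"
        using f g m by (auto simp: is_iso_def)
      have "pairs K = (\<lambda>p. g ` p) ` (\<lambda>p. f ` p) ` pairs G"
        using f g by (simp add: is_iso_def)
      thus "(\<lambda>p. (g \<circ> f) ` p) ` pairs G = pairs K"
        by (simp add: image_image image_comp)
    qed
    thus "(G, K) \<in> iso_rel" using ar by (auto simp: iso_rel_def)
  qed
qed

text \<open>A forest is an isomorphism class of representatives.\<close>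

type_synonym 'c forest = "'c forest_graph set"

definition iso_class :: "'c forest_graph \<Rightarrow> 'c forest" where
  "iso_class G = iso_rel `` {G}"

definition decorated_forests :: "'c set \<Rightarrow> 'c forest set" where
  "decorated_forests D = {G. decorated_graph D G} // iso_rel"

definition grafted_forests :: "'c forest set" where
  "grafted_forests = {G. grafted_graph G} // iso_rel"

definition exotic_forests :: "'c forest set" where
  "exotic_forests = {G. exotic_graph G} // iso_rel"

text \<open>The operations on forests below are defined through an arbitrary representative; they do not
  depend on its choice.\<close>

definition rep :: "'c forest \<Rightarrow> 'c forest_graph" where
  "rep \<pi> = (SOME G. G \<in> \<pi>)"

definition num_verts :: "'c forest \<Rightarrow> nat" where
  "num_verts \<pi> = card (verts (rep \<pi>))"

definition symmetry :: "'c forest \<Rightarrow> nat" where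
  "symmetry \<pi> = card {f. f permutes verts (rep \<pi>) \<and> is_iso f (rep \<pi>) (rep \<pi>)}"

text \<open>For infinite \<open>D\<close> there are infinitely many forests with a given number of vertices, and sums over
  them are formal. An identity between such formal sums is stated on the forests with decorations in each
  finite set \<open>C\<close>, of which there are finitely many with a given number of vertices.\<close>

definition with_decorations :: "'c decoration set \<Rightarrow> 'c forest set \<Rightarrow> 'c forest set" where
  "with_decorations C A = {\<pi> \<in> A. deco (rep \<pi>) ` verts (rep \<pi>) \<subseteq> C}"

section \<open>Spans of forests\<close>

instantiation poly_mapping :: (type, real_vector) real_vector
begin

definition scaleR_poly_mapping :: "real \<Rightarrow> ('a \<Rightarrow>\<^sub>0 'b) \<Rightarrow> ('a \<Rightarrow>\<^sub>0 'b)" where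
  "scaleR_poly_mapping c p = Poly_Mapping.map (scaleR c) p"

lemma lookup_scaleR: "Poly_Mapping.lookup (c *\<^sub>R p) k = c *\<^sub>R Poly_Mapping.lookup p k"
  by (simp add: scaleR_poly_mapping_def map.rep_eq when_def)

instance
  by standard (auto intro!: poly_mapping_eqI
      simp: lookup_scaleR Poly_Mapping.lookup_add scaleR_add_right scaleR_add_left)

end

text \<open>The real vector space with basis \<open>A\<close>; the basis vector of \<open>\<pi> \<in> A\<close> is \<open>single \<pi> 1\<close>.\<close>

definition free_space :: "'x set \<Rightarrow> ('x \<Rightarrow>\<^sub>0 real) set" where
  "free_space A = {p. Poly_Mapping.keys p \<subseteq> A}"

abbreviation basis_vec :: "'x \<Rightarrow> ('x \<Rightarrow>\<^sub>0 real)" where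
  "basis_vec x \<equiv> Poly_Mapping.single x 1"

definition linear_extension :: "('x \<Rightarrow> 'v::real_vector) \<Rightarrow> ('x \<Rightarrow>\<^sub>0 real) \<Rightarrow> 'v" where
  "linear_extension g p = (\<Sum>x \<in> Poly_Mapping.keys p. Poly_Mapping.lookup p x *\<^sub>R g x)"

definition linear_functional_on :: "'v::real_vector set \<Rightarrow> ('v \<Rightarrow> real) \<Rightarrow> bool" where
  "linear_functional_on V a \<longleftrightarrow>
     (\<forall>p \<in> V. \<forall>q \<in> V. a (p + q) = a p + a q) \<and> (\<forall>c. \<forall>p \<in> V. a (c *\<^sub>R p) = c * a p)"

section \<open>Grossman--Larson product\<close>

text \<open>A map from the roots of \<open>G\<close> to \<open>V(H) \<squnion> {*}\<close>, with \<open>None\<close> for \<open>*\<close>. Maps hitting a cross contribute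
  zero to the product and are left out (forests decorated by \<open>D\<close> have no crosses, so nothing is left out there).\<close>

definition attachments :: "'c forest_graph \<Rightarrow> 'c forest_graph \<Rightarrow> (nat \<Rightarrow> nat option) set" where
  "attachments G H = roots G \<rightarrow>\<^sub>E insert None (Some ` (verts H - crosses H))"

abbreviation (input) left_vertex :: "nat \<Rightarrow> nat" where
  "left_vertex v \<equiv> sum_encode (Inl v)"

abbreviation (input) right_vertex :: "nat \<Rightarrow> nat" where
  "right_vertex v \<equiv> sum_encode (Inr v)"

definition graft :: "'c forest_graph \<Rightarrow> 'c forest_graph \<Rightarrow> (nat \<Rightarrow> nat option) \<Rightarrow> 'c forest_graph" where
  "graft G H h =
     \<lparr> verts = left_vertex ` verts G \<union> right_vertex ` verts H,
       edges = map_prod left_vertex left_vertex ` edges G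
             \<union> map_prod right_vertex right_vertex ` edges H
             \<union> {(left_vertex r, right_vertex v) | r v. r \<in> roots G \<and> h r = Some v},
       deco = (\<lambda>n. case sum_decode n of Inl v \<Rightarrow> deco G v | Inr v \<Rightarrow> deco H v),
       pairs = (\<lambda>p. left_vertex ` p) ` pairs G \<union> (\<lambda>p. right_vertex ` p) ` pairs H \<rparr>"

definition gl_forests :: "'c forest \<Rightarrow> 'c forest \<Rightarrow> ('c forest \<Rightarrow>\<^sub>0 real)" where
  "gl_forests \<pi>\<^sub>1 \<pi>\<^sub>2 =
     (\<Sum>h \<in> attachments (rep \<pi>\<^sub>1) (rep \<pi>\<^sub>2). basis_vec (iso_class (graft (rep \<pi>\<^sub>1) (rep \<pi>\<^sub>2) h)))"

definition grossman_larson ::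
    "('c forest \<Rightarrow>\<^sub>0 real) \<Rightarrow> ('c forest \<Rightarrow>\<^sub>0 real) \<Rightarrow> ('c forest \<Rightarrow>\<^sub>0 real)"  (infixl "\<diamondop>" 70) where
  "p \<diamondop> q = linear_extension (\<lambda>\<pi>\<^sub>1. linear_extension (gl_forests \<pi>\<^sub>1) q) p"

section \<open>Connes--Kreimer coproduct\<close>

definition induced :: "'c forest_graph \<Rightarrow> nat set \<Rightarrow> 'c forest_graph" where
  "induced G U =
     \<lparr> verts = U, edges = edges G \<inter> U \<times> U, deco = deco G, pairs = {p \<in> pairs G. p \<subseteq> U} \<rparr>"

definition admissible :: "'c forest_graph \<Rightarrow> nat set set" where
  "admissible G = {U. U \<subseteq> verts G \<and>
     aromatic_graph (induced G U) \<and> aromatic_graph (induced G (verts G - U)) \<and>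
     (\<forall>(u, v) \<in> edges G. \<not> (u \<in> U \<and> v \<in> verts G - U)) \<and>
     (\<forall>p \<in> pairs G. p \<subseteq> U \<or> p \<subseteq> verts G - U)}"

text \<open>The tensor square of the space with basis \<open>A\<close> is the space with basis \<open>A \<times> A\<close>.\<close>

definition ck_forest :: "'c forest \<Rightarrow> ('c forest \<times> 'c forest \<Rightarrow>\<^sub>0 real)" where
  "ck_forest \<pi> = (\<Sum>U \<in> admissible (rep \<pi>).
     basis_vec (iso_class (induced (rep \<pi>) (verts (rep \<pi>) - U)), iso_class (induced (rep \<pi>) U)))"

definition connes_kreimer :: "('c forest \<Rightarrow>\<^sub>0 real) \<Rightarrow> ('c forest \<times> 'c forest \<Rightarrow>\<^sub>0 real)" where
  "connes_kreimer = linear_extension ck_forest"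

text \<open>The functional \<open>m\<^sub>\<real> \<circ> (a \<otimes> b)\<close> on the tensor square.\<close>

definition tensor_mult ::
    "(('x \<Rightarrow>\<^sub>0 real) \<Rightarrow> real) \<Rightarrow> (('x \<Rightarrow>\<^sub>0 real) \<Rightarrow> real) \<Rightarrow> ('x \<times> 'x \<Rightarrow>\<^sub>0 real) \<Rightarrow> real" where
  "tensor_mult a b = linear_extension (\<lambda>(x, y). a (basis_vec x) * b (basis_vec y))"

definition convolution ::
    "(('c forest \<Rightarrow>\<^sub>0 real) \<Rightarrow> real) \<Rightarrow> (('c forest \<Rightarrow>\<^sub>0 real) \<Rightarrow> real) \<Rightarrow> ('c forest \<Rightarrow>\<^sub>0 real) \<Rightarrow> real"
    (infixl "\<star>" 70) where
  "a \<star> b = tensor_mult a b \<circ> connes_kreimer"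

section \<open>Test functions and differential operators\<close>

definition partial_deriv :: "'d \<Rightarrow> (real ^ 'd \<Rightarrow> real) \<Rightarrow> (real ^ 'd \<Rightarrow> real)" where
  "partial_deriv i \<phi> x = frechet_derivative \<phi> (at x) (axis i 1)"

definition iterated_partial :: "'d list \<Rightarrow> (real ^ 'd \<Rightarrow> real) \<Rightarrow> (real ^ 'd \<Rightarrow> real)" where
  "iterated_partial is \<phi> = foldr partial_deriv is \<phi>"

definition smooth :: "(real ^ 'd \<Rightarrow> real) \<Rightarrow> bool" where
  "smooth \<phi> \<longleftrightarrow> (\<forall>is x. iterated_partial is \<phi> differentiable (at x))"

definition test_function :: "(real ^ 'd \<Rightarrow> real) \<Rightarrow> bool" where
  "test_function \<phi> \<longleftrightarrow> smooth \<phi> \<and>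
     (\<forall>is. \<exists>K k. \<forall>x. \<bar>iterated_partial is \<phi> x\<bar> \<le> K * (1 + norm x) ^ k)"

text \<open>Differential operators with smooth coefficients act on smooth functions; the value of \<open>L\<close> on other
  functions is irrelevant.\<close>

definition differential_operator :: "((real ^ 'd \<Rightarrow> real) \<Rightarrow> (real ^ 'd \<Rightarrow> real)) \<Rightarrow> bool" where
  "differential_operator L \<longleftrightarrow> (\<exists>I c. finite I \<and> (\<forall>is \<in> I. smooth (c is)) \<and>
     (\<forall>\<phi>. smooth \<phi> \<longrightarrow> (\<forall>x. L \<phi> x = (\<Sum>is \<in> I. c is x * iterated_partial is \<phi> x))))"

type_synonym ('c, 'd) forest_operator =
  "('c forest \<Rightarrow>\<^sub>0 real) \<Rightarrow> (real ^ 'd \<Rightarrow> real) \<Rightarrow> (real ^ 'd \<Rightarrow> real)"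

definition linear_to_operators :: "'c forest set \<Rightarrow> ('c, 'd::finite) forest_operator \<Rightarrow> bool" where
  "linear_to_operators A F \<longleftrightarrow>
     (\<forall>p \<in> free_space A. differential_operator (F p)) \<and>
     (\<forall>\<phi> x. smooth \<phi> \<longrightarrow> linear_functional_on (free_space A) (\<lambda>p. F p \<phi> x))"

definition multiplicative :: "'c forest set \<Rightarrow> ('c, 'd::finite) forest_operator \<Rightarrow> bool" where
  "multiplicative A F \<longleftrightarrow>
     (\<forall>p \<in> free_space A. \<forall>q \<in> free_space A. \<forall>\<phi>. smooth \<phi> \<longrightarrow> F (p \<diamondop> q) \<phi> = F p (F q \<phi>))"

section \<open>S-series\<close>

text \<open>A formal series graded by the number of vertices is the sequence of its homogeneous components.
  The index sets of the sums are finite when finitely many decorations occur in \<open>A\<close>.\<close>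

definition S_series ::
    "('c, 'd::finite) forest_operator \<Rightarrow> 'c forest set \<Rightarrow> (('c forest \<Rightarrow>\<^sub>0 real) \<Rightarrow> real) \<Rightarrow>
     (real ^ 'd \<Rightarrow> real) \<Rightarrow> nat \<Rightarrow> real ^ 'd \<Rightarrow> real" where
  "S_series F A a \<phi> n x =
     (\<Sum>\<pi> \<in> {\<pi> \<in> A. num_verts \<pi> = n}.
        a (basis_vec \<pi>) / real (symmetry \<pi>) * F (basis_vec \<pi>) \<phi> x)"

text \<open>The formal double series \<open>S(a)[S(b)[\<phi>]]\<close>, regrouped by total number of vertices.\<close>

definition S_series_comp ::
    "('c, 'd::finite) forest_operator \<Rightarrow> 'c forest set \<Rightarrow> (('c forest \<Rightarrow>\<^sub>0 real) \<Rightarrow> real) \<Rightarrow>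
     (('c forest \<Rightarrow>\<^sub>0 real) \<Rightarrow> real) \<Rightarrow> (real ^ 'd \<Rightarrow> real) \<Rightarrow> nat \<Rightarrow> real ^ 'd \<Rightarrow> real" where
  "S_series_comp F A a b \<phi> n x =
     (\<Sum>(\<pi>\<^sub>1, \<pi>\<^sub>2) \<in> {(\<pi>\<^sub>1, \<pi>\<^sub>2) \<in> A \<times> A. num_verts \<pi>\<^sub>1 + num_verts \<pi>\<^sub>2 = n}.
        a (basis_vec \<pi>\<^sub>1) * b (basis_vec \<pi>\<^sub>2) / (real (symmetry \<pi>\<^sub>1) * real (symmetry \<pi>\<^sub>2)) *
        F (basis_vec \<pi>\<^sub>1) (F (basis_vec \<pi>\<^sub>2) \<phi>) x)"

end

(*
  Applied to basis forests, the composition S(a)[S(b)[.]] expands into the differential operators of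
  the forests occurring in the Grossman-Larson products, so comparing coefficients of F(pi) reduces
  the theorem to the following: for forests pi1, pi2, pi, the number of graftings of pi1 onto pi2 giving
  pi, divided by sigma(pi1) sigma(pi2), equals the number of cuts of pi into pi1 and pi2, divided by
  sigma(pi). Both are obtained by counting in two ways the pairs of an attachment map h and an
  isomorphism from the grafted graph onto pi: restricting such an isomorphism to the two parts of the
  graft gives a cut of pi with identifications of its parts with pi1 and pi2, and h is recovered from the
  edges of pi crossing the cut.
*)

theory Submission
  imports Defs
begin

section \<open>Isomorphisms\<close>

text \<open>Forests are reached only through arbitrarily chosen representatives, so everything is
  counted on labelled graphs: whenever two graphs are isomorphic, the number of isomorphisms is the
  symmetry factor, which is how the sigmas arise. The attachment map can be read off from the
  crossing edges because out-degrees are at most one. A vertex with an edge across the cut has no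
  other outgoing edge, hence is a root of the upper part, and each such root has at most one
  crossing edge. Crosses agree on both sides: \<open>attachments\<close> avoids them, and no edge of
  a forest in the three families ends at one. The sums must be finite, since a sum over an infinite
  index set is 0 by convention. For infinite \<open>D\<close> the forests are therefore restricted
  to a finite set of decorations. Grafting and cutting preserve this restriction, so the three
  families and all their restrictions are instances of the single locale \<open>graph_class\<close>,
  on which the identity is proved once.\<close>

definition isos :: "'c forest_graph \<Rightarrow> 'c forest_graph \<Rightarrow> (nat \<Rightarrow> nat) set" where
  "isos G H = {f \<in> extensional (verts G). is_iso f G H}"

lemma aromatic_pairs_subset:
  "aromatic_graph G \<Longrightarrow> p \<in> pairs G \<Longrightarrow> p \<subseteq> verts G"
  by (auto simp: aromatic_graph_def)

text \<open>The matching enters \<open>is_iso\<close> through images of the pairs, and these depend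
  only on values on the vertices because the pairs of an aromatic graph lie there. This allows an
  isomorphism to be replaced by its restriction, the normal form used in
  \<open>isos\<close>.\<close>

lemma is_iso_cong:
  assumes "aromatic_graph G" and eq: "\<And>v. v \<in> verts G \<Longrightarrow> f v = g v"
  shows "is_iso f G H \<longleftrightarrow> is_iso g G H"
proof -
  have "f ` p = g ` p" if "p \<in> pairs G" for p
    using aromatic_pairs_subset[OF assms(1) that] eq by (auto intro!: image_cong)
  hence "(\<lambda>p. f ` p) ` pairs G = (\<lambda>p. g ` p) ` pairs G" by (rule image_cong[OF refl])
  moreover have "bij_betw f (verts G) (verts H) \<longleftrightarrow> bij_betw g (verts G) (verts H)"
    by (rule bij_betw_cong) (rule eq)
  ultimately show ?thesis using eq by (auto simp: is_iso_def)
qed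

lemma is_iso_mem: "is_iso f G H \<Longrightarrow> v \<in> verts G \<Longrightarrow> f v \<in> verts H"
  by (auto simp: is_iso_def bij_betw_def)

lemma is_iso_edge:
  "is_iso f G H \<Longrightarrow> u \<in> verts G \<Longrightarrow> v \<in> verts G \<Longrightarrow>
    (f u, f v) \<in> edges H \<longleftrightarrow> (u, v) \<in> edges G"
  by (simp add: is_iso_def)

lemma is_iso_comp:
  assumes "is_iso f G H" and "is_iso g H K"
  shows "is_iso (g \<circ> f) G K"
  unfolding is_iso_def
proof (intro conjI)
  show "bij_betw (g \<circ> f) (verts G) (verts K)"
    using assms by (auto simp: is_iso_def intro: bij_betw_trans)
  show "\<forall>u\<in>verts G. \<forall>v\<in>verts G. ((u, v) \<in> edges G) = (((g \<circ> f) u, (g \<circ> f) v) \<in> edges K)"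
    using assms is_iso_mem[OF assms(1)] by (auto simp: is_iso_def)
  show "\<forall>v\<in>verts G. deco G v = deco K ((g \<circ> f) v)"
    using assms is_iso_mem[OF assms(1)] by (auto simp: is_iso_def)
  have "pairs K = (\<lambda>p. g ` p) ` (\<lambda>p. f ` p) ` pairs G"
    using assms by (simp add: is_iso_def)
  thus "(\<lambda>p. (g \<circ> f) ` p) ` pairs G = pairs K"
    by (simp add: image_image image_comp)
qed

lemma is_iso_inv:
  assumes "aromatic_graph G" and f: "is_iso f G H"
  shows "is_iso (inv_into (verts G) f) H G"
proof -
  let ?g = "inv_into (verts G) f"
  have bij: "bij_betw f (verts G) (verts H)" using f by (simp add: is_iso_def)
  have g: "?g v \<in> verts G" "f (?g v) = v" if "v \<in> verts H" for v
    using that bij by (auto simp: bij_betw_def inv_into_into f_inv_into_f)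
  have "?g ` f ` p = p" if "p \<in> pairs G" for p
    using aromatic_pairs_subset[OF assms(1) that] bij
    by (simp add: bij_betw_def inv_into_image_cancel)
  hence "(\<lambda>p. ?g ` p) ` (\<lambda>p. f ` p) ` pairs G = pairs G" by (simp add: image_image)
  thus ?thesis
    using f g bij_betw_inv_into[OF bij] unfolding is_iso_def by auto
qed

text \<open>Supplies, among others, the aromaticity demanded by \<open>admissible\<close>, since
  both parts of a cut are isomorphic to given aromatic graphs. The edge condition is assumed because
  \<open>is_iso\<close> compares edges between vertices only.\<close>

lemma is_iso_aromatic:
  assumes "aromatic_graph G" and f: "is_iso f G H" and E: "edges H \<subseteq> verts H \<times> verts H"
  shows "aromatic_graph H"
proof -
  let ?g = "inv_into (verts G) f"
  have g: "is_iso ?g H G" by (rule is_iso_inv[OF assms(1,2)])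
  have bijg: "bij_betw ?g (verts H) (verts G)" using g by (simp add: is_iso_def)
  have edge: "(?g u, ?g v) \<in> edges G" if "(u, v) \<in> edges H" for u v
    using that g E by (auto simp: is_iso_def)
  have fin: "finite (verts H)"
    using assms(1) bijg by (auto simp: aromatic_graph_def bij_betw_finite)
  have "single_valued (edges H)"
  proof (rule single_valuedI)
    fix x y z assume xy: "(x, y) \<in> edges H" and xz: "(x, z) \<in> edges H"
    have "single_valued (edges G)" using assms(1) by (simp add: aromatic_graph_def)
    hence "?g y = ?g z"
      using edge[OF xy] edge[OF xz] by (rule single_valuedD)
    thus "y = z" using xy xz E bijg by (auto simp: bij_betw_def inj_on_def)
  qed
  moreover have "verts H = {} \<or> roots H \<noteq> {}"
  proof (cases "verts G = {}")
    case True
    thus ?thesis using bijg by (simp add: bij_betw_def)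
  next
    case False
    then obtain r where r: "r \<in> roots G" using assms(1) by (auto simp: aromatic_graph_def)
    hence rv: "r \<in> verts G" by (simp add: roots_def)
    have "?g (f r) = r" using rv f by (simp add: is_iso_def bij_betw_def)
    hence "f r \<in> roots H"
      using r edge is_iso_mem[OF f rv] by (fastforce simp: roots_def)
    thus ?thesis by auto
  qed
  moreover have "\<Union> (pairs H) \<subseteq> verts H"
  proof -
    have "pairs H = (\<lambda>p. f ` p) ` pairs G" using f by (simp add: is_iso_def)
    thus ?thesis using aromatic_pairs_subset[OF assms(1)] is_iso_mem[OF f] by fastforce
  qed
  ultimately show ?thesis using fin E by (simp add: aromatic_graph_def)
qed

lemma iso_class_eq_iff:
  assumes "aromatic_graph G" and "aromatic_graph H"
  shows "iso_class G = iso_class H \<longleftrightarrow> isos G H \<noteq> {}"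
proof -
  have "iso_class G = iso_class H \<longleftrightarrow> (G, H) \<in> iso_rel"
    unfolding iso_class_def by (rule eq_equiv_class_iff[OF equiv_iso_rel]) (use assms in auto)
  also have "\<dots> \<longleftrightarrow> (\<exists>f. is_iso f G H)" using assms by (simp add: iso_rel_def)
  also have "\<dots> \<longleftrightarrow> isos G H \<noteq> {}"
  proof
    assume "\<exists>f. is_iso f G H"
    then obtain f where f: "is_iso f G H" ..
    have "is_iso (restrict f (verts G)) G H"
      using f is_iso_cong[OF assms(1), of "restrict f (verts G)" f H] by simp
    thus "isos G H \<noteq> {}" by (auto simp: isos_def)
  qed (auto simp: isos_def)
  finally show ?thesis .
qed

section \<open>Counting isomorphisms\<close>

lemma finite_isos:
  assumes "aromatic_graph G" and "aromatic_graph H"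
  shows "finite (isos G H)"
proof (rule finite_subset)
  show "isos G H \<subseteq> verts G \<rightarrow>\<^sub>E verts H"
    by (auto simp: isos_def PiE_def is_iso_mem)
  show "finite (verts G \<rightarrow>\<^sub>E verts H)"
    using assms by (intro finite_PiE) (auto simp: aromatic_graph_def)
qed

text \<open>Transport \<open>k\<close> to \<open>g \<circ> k \<circ> f\<close>. This is injective in
  \<open>k\<close>, as \<open>f\<close> reaches every vertex of \<open>G\<close> and
  \<open>g\<close> is injective on those of \<open>H\<close>. Applied in both directions it shows
  that the count depends on the classes alone.\<close>

lemma card_isos_le:
  assumes "aromatic_graph G" "aromatic_graph G'" "aromatic_graph H'"
    and f: "is_iso f G' G" and g: "is_iso g H H'"
  shows "card (isos G H) \<le> card (isos G' H')"
proof (rule card_inj_on_le)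
  let ?T = "\<lambda>k. restrict (g \<circ> k \<circ> f) (verts G')"
  show "?T ` isos G H \<subseteq> isos G' H'"
  proof
    fix m assume "m \<in> ?T ` isos G H"
    then obtain k where k: "is_iso k G H" "m = ?T k" by (auto simp: isos_def)
    have "is_iso (g \<circ> (k \<circ> f)) G' H'" by (intro is_iso_comp[OF _ g] is_iso_comp[OF f] k)
    hence "is_iso m G' H'"
      using is_iso_cong[OF assms(2), of m "g \<circ> (k \<circ> f)" H'] k by simp
    thus "m \<in> isos G' H'" by (simp add: isos_def k)
  qed
  show "inj_on ?T (isos G H)"
  proof (rule inj_onI)
    fix k m assume k: "k \<in> isos G H" and m: "m \<in> isos G H" and eq: "?T k = ?T m"
    show "k = m"
    proof (rule extensionalityI)
      show "k \<in> extensional (verts G)" "m \<in> extensional (verts G)"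
        using k m by (auto simp: isos_def)
      fix v assume "v \<in> verts G"
      moreover have "f ` verts G' = verts G" using f by (simp add: is_iso_def bij_betw_def)
      ultimately obtain u where u: "u \<in> verts G'" "v = f u" by blast
      have "g (k v) = g (m v)" using fun_cong[OF eq, of u] u by simp
      moreover have "k v \<in> verts H" "m v \<in> verts H"
        using k m \<open>v \<in> verts G\<close> by (auto simp: isos_def is_iso_mem)
      ultimately show "k v = m v"
        using g by (auto simp: is_iso_def bij_betw_def inj_on_def)
    qed
  qed
  show "finite (isos G' H')" by (rule finite_isos[OF assms(2,3)])
qed

lemma card_isos_eq:
  assumes G: "aromatic_graph G" "aromatic_graph G'" "iso_class G = iso_class G'"
    and H: "aromatic_graph H" "aromatic_graph H'" "iso_class H = iso_class H'"
  shows "card (isos G H) = card (isos G' H')"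
proof -
  obtain f where f: "is_iso f G G'" using G by (auto simp: iso_class_eq_iff isos_def)
  obtain f' where f': "is_iso f' G' G"
    using is_iso_inv[OF G(1) f] by blast
  obtain g where g: "is_iso g H H'" using H by (auto simp: iso_class_eq_iff isos_def)
  obtain g' where g': "is_iso g' H' H"
    using is_iso_inv[OF H(1) g] by blast
  show ?thesis
    using card_isos_le[OF G(1,2) H(2) f' g] card_isos_le[OF G(2,1) H(1) f g'] by simp
qed

text \<open>Reconciles two normal forms off the vertex set: permutations are the identity there,
  members of \<open>isos\<close> are undefined there.\<close>

lemma card_isos_self:
  assumes "aromatic_graph G"
  shows "card (isos G G) = card {f. f permutes verts G \<and> is_iso f G G}"
proof (rule sym, rule bij_betw_same_card)
  show "bij_betw (\<lambda>f. restrict f (verts G)) {f. f permutes verts G \<and> is_iso f G G} (isos G G)"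
  proof (rule bij_betw_byWitness[where f' = "\<lambda>f v. if v \<in> verts G then f v else v"])
    show "\<forall>f\<in>{f. f permutes verts G \<and> is_iso f G G}.
        (\<lambda>v. if v \<in> verts G then restrict f (verts G) v else v) = f"
      by (auto simp: permutes_def fun_eq_iff)
    show "\<forall>f\<in>isos G G. restrict (\<lambda>v. if v \<in> verts G then f v else v) (verts G) = f"
      by (auto simp: isos_def fun_eq_iff extensional_def)
    have "is_iso (restrict f (verts G)) G G" if "is_iso f G G" for f
      using that is_iso_cong[OF assms, of "restrict f (verts G)" f G] by simp
    thus "(\<lambda>f. restrict f (verts G)) ` {f. f permutes verts G \<and> is_iso f G G} \<subseteq> isos G G"
      by (auto simp: isos_def)
    have "(\<lambda>v. if v \<in> verts G then f v else v) permutes verts G \<and>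
        is_iso (\<lambda>v. if v \<in> verts G then f v else v) G G" if f: "is_iso f G G" for f
    proof
      have "bij_betw (\<lambda>v. if v \<in> verts G then f v else v) (verts G) (verts G)"
        using f bij_betw_cong[of "verts G" "\<lambda>v. if v \<in> verts G then f v else v" f]
        by (simp add: is_iso_def)
      thus "(\<lambda>v. if v \<in> verts G then f v else v) permutes verts G"
        by (rule bij_imp_permutes) simp
      show "is_iso (\<lambda>v. if v \<in> verts G then f v else v) G G"
        using f is_iso_cong[OF assms, of "\<lambda>v. if v \<in> verts G then f v else v" f G] by simp
    qed
    thus "(\<lambda>f v. if v \<in> verts G then f v else v) ` isos G G
        \<subseteq> {f. f permutes verts G \<and> is_iso f G G}"
      by (auto simp: isos_def)
  qed
qed

lemma rep_iso_class:
  assumes "aromatic_graph G"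
  shows "aromatic_graph (rep (iso_class G))" and "iso_class (rep (iso_class G)) = iso_class G"
proof -
  have "(G, G) \<in> iso_rel"
    using equiv_iso_rel assms by (auto simp: equiv_def refl_on_def)
  hence "G \<in> iso_class G" by (simp add: iso_class_def)
  hence r: "rep (iso_class G) \<in> iso_class G" unfolding rep_def by (rule someI)
  thus "aromatic_graph (rep (iso_class G))" by (auto simp: iso_class_def iso_rel_def)
  have "(G, rep (iso_class G)) \<in> iso_rel" using r by (simp add: iso_class_def)
  thus "iso_class (rep (iso_class G)) = iso_class G"
    unfolding iso_class_def using equiv_class_eq[OF equiv_iso_rel] by metis
qed

lemma rep_iso_class_iso:
  assumes "aromatic_graph G"
  obtains f where "is_iso f G (rep (iso_class G))"
  using iso_class_eq_iff[OF assms rep_iso_class(1)[OF assms]] rep_iso_class(2)[OF assms]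
  by (auto simp: isos_def)

lemma num_verts_iso_class:
  assumes "aromatic_graph G"
  shows "num_verts (iso_class G) = card (verts G)"
proof -
  obtain f where "is_iso f G (rep (iso_class G))" by (rule rep_iso_class_iso[OF assms])
  hence "bij_betw f (verts G) (verts (rep (iso_class G)))" by (simp add: is_iso_def)
  thus ?thesis unfolding num_verts_def by (simp add: bij_betw_same_card)
qed

text \<open>If the classes agree, both graphs may be replaced by the representative of the common
  class, and its isomorphisms to itself are counted by \<open>symmetry\<close>. All symmetry factors
  enter the double count through this lemma.\<close>

lemma card_isos_forest:
  assumes "aromatic_graph G" and "aromatic_graph H"
  shows "card (isos G H) = (if iso_class G = iso_class H then symmetry (iso_class H) else 0)"
proof (cases "iso_class G = iso_class H")
  case True
  have "card (isos G H) = card (isos (rep (iso_class H)) (rep (iso_class H)))"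
    using assms True by (intro card_isos_eq) (auto simp: rep_iso_class)
  thus ?thesis
    using True card_isos_self[OF rep_iso_class(1)[OF assms(2)]] by (simp add: symmetry_def)
next
  case False
  thus ?thesis using iso_class_eq_iff[OF assms] by simp
qed

lemma symmetry_pos:
  assumes "aromatic_graph G"
  shows "symmetry (iso_class G) > 0"
proof -
  have "card (isos G G) > 0"
    using iso_class_eq_iff[OF assms assms] finite_isos[OF assms assms] by (simp add: card_gt_0_iff)
  thus ?thesis using card_isos_forest[OF assms assms] by simp
qed

section \<open>Grafting and cutting\<close>

lemma verts_graft [simp]: "verts (graft G H h) = left_vertex ` verts G \<union> right_vertex ` verts H"
  and deco_graft_left [simp]: "deco (graft G H h) (left_vertex v) = deco G v"
  and deco_graft_right [simp]: "deco (graft G H h) (right_vertex v) = deco H v"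
  and pairs_graft: "pairs (graft G H h) =
    (\<lambda>p. left_vertex ` p) ` pairs G \<union> (\<lambda>p. right_vertex ` p) ` pairs H"
  by (simp_all add: graft_def)

lemma edges_graft [simp]:
  "(left_vertex u, left_vertex v) \<in> edges (graft G H h) \<longleftrightarrow> (u, v) \<in> edges G"
  "(right_vertex u, right_vertex v) \<in> edges (graft G H h) \<longleftrightarrow> (u, v) \<in> edges H"
  "(left_vertex u, right_vertex v) \<in> edges (graft G H h) \<longleftrightarrow> u \<in> roots G \<and> h u = Some v"
  "(right_vertex u, left_vertex v) \<notin> edges (graft G H h)"
  by (auto simp: graft_def sum_encode_eq)

lemma edges_graft_cases:
  assumes "(x, y) \<in> edges (graft G H h)"
  obtains u v where "x = left_vertex u" "y = left_vertex v" "(u, v) \<in> edges G"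
  | u v where "x = right_vertex u" "y = right_vertex v" "(u, v) \<in> edges H"
  | u v where "x = left_vertex u" "y = right_vertex v" "u \<in> roots G" "h u = Some v"
  using assms by (auto simp: graft_def)

lemma attachments_Some:
  assumes "h \<in> attachments G H" "r \<in> roots G" "h r = Some v"
  shows "v \<in> verts H" "deco H v \<noteq> Cross"
  using PiE_mem[OF assms(1)[unfolded attachments_def] assms(2)] assms(3)
  by (auto simp: crosses_def)

text \<open>New edges start at roots of \<open>G\<close>, which had no outgoing edge, so the edges
  stay single-valued. A nonempty \<open>H\<close> keeps its roots, since no new edge starts in
  \<open>H\<close>.\<close>

lemma aromatic_graft:
  assumes G: "aromatic_graph G" and H: "aromatic_graph H" and h: "h \<in> attachments G H"
  shows "aromatic_graph (graft G H h)"
  unfolding aromatic_graph_def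
proof (intro conjI)
  show "finite (verts (graft G H h))" using G H by (auto simp: aromatic_graph_def)
  show "edges (graft G H h) \<subseteq> verts (graft G H h) \<times> verts (graft G H h)"
  proof safe
    fix x y assume "(x, y) \<in> edges (graft G H h)"
    hence "x \<in> verts (graft G H h) \<and> y \<in> verts (graft G H h)"
      by (cases rule: edges_graft_cases)
        (use G H h in \<open>auto simp: aromatic_graph_def roots_def dest: attachments_Some(1)\<close>)
    thus "x \<in> verts (graft G H h)" "y \<in> verts (graft G H h)" by auto
  qed
  show "single_valued (edges (graft G H h))"
  proof (rule single_valuedI)
    fix x y z assume xy: "(x, y) \<in> edges (graft G H h)" and xz: "(x, z) \<in> edges (graft G H h)"
    have "single_valued (edges G)" "single_valued (edges H)"
      using G H by (auto simp: aromatic_graph_def)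
    thus "y = z"
      by (cases rule: edges_graft_cases[OF xy]; cases rule: edges_graft_cases[OF xz])
        (auto simp: sum_encode_eq roots_def single_valued_def)
  qed
  show "verts (graft G H h) = {} \<or> roots (graft G H h) \<noteq> {}"
  proof (cases "verts H = {}")
    case False
    then obtain r where r: "r \<in> roots H" using H by (auto simp: aromatic_graph_def)
    have "right_vertex r \<in> roots (graft G H h)"
      unfolding roots_def
    proof (intro CollectI conjI allI notI)
      show "right_vertex r \<in> verts (graft G H h)" using r by (auto simp: roots_def)
      fix w assume "(right_vertex r, w) \<in> edges (graft G H h)"
      thus False
        by (cases rule: edges_graft_cases) (use r in \<open>auto simp: sum_encode_eq roots_def\<close>)
    qed
    thus ?thesis by auto
  next
    \<comment> \<open>Without vertices in \<open>H\<close> the only value an attachment map can take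
      on a root is \<open>None\<close>, so the roots of \<open>G\<close> remain roots.\<close>
    case empty: True
    show ?thesis
    proof (cases "verts G = {}")
      case False
      then obtain r where r: "r \<in> roots G" using G by (auto simp: aromatic_graph_def)
      have "left_vertex r \<in> roots (graft G H h)"
        unfolding roots_def
      proof (intro CollectI conjI allI notI)
        show "left_vertex r \<in> verts (graft G H h)" using r by (auto simp: roots_def)
        fix w assume "(left_vertex r, w) \<in> edges (graft G H h)"
        thus False
          by (cases rule: edges_graft_cases)
            (use r empty attachments_Some(1)[OF h] in \<open>auto simp: sum_encode_eq roots_def\<close>)
      qed
      thus ?thesis by auto
    qed (use empty in simp)
  qed
  show "\<Union> (pairs (graft G H h)) \<subseteq> verts (graft G H h)"
    using aromatic_pairs_subset[OF G] aromatic_pairs_subset[OF H]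
    by (fastforce simp: pairs_graft)
qed

section \<open>The correspondence between isomorphisms from grafts and cuts with identified
  parts\<close>

lemma verts_induced [simp]: "verts (induced G U) = U"
  and edges_induced [simp]: "edges (induced G U) = edges G \<inter> U \<times> U"
  and deco_induced [simp]: "deco (induced G U) = deco G"
  and pairs_induced [simp]: "pairs (induced G U) = {p \<in> pairs G. p \<subseteq> U}"
  by (simp_all add: induced_def)

text \<open>The empty pair is excluded because both parts of a cut would inherit it.\<close>

definition proper_graph :: "'c forest_graph \<Rightarrow> bool" where
  "proper_graph G \<longleftrightarrow>
     aromatic_graph G \<and> {} \<notin> pairs G \<and> (\<forall>(u, v) \<in> edges G. deco G v \<noteq> Cross)"

text \<open>The chosen set is the image of \<open>H\<close>, because the edges added by
  \<open>graft\<close> enter the \<open>H\<close> part, while no edge of a cut may leave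
  \<open>U\<close>. The map \<open>h\<close> is forgotten. The two halves of \<open>f\<close> are
  restricted so that they become members of \<open>isos\<close>.\<close>

definition cut ::
    "'c forest_graph \<Rightarrow> 'c forest_graph \<Rightarrow> (nat \<Rightarrow> nat option) \<times> (nat \<Rightarrow> nat) \<Rightarrow>
     nat set \<times> (nat \<Rightarrow> nat) \<times> (nat \<Rightarrow> nat)" where
  "cut G H = (\<lambda>(h, f). (f ` right_vertex ` verts H,
     restrict (f \<circ> left_vertex) (verts G), restrict (f \<circ> right_vertex) (verts H)))"

lemma Collect_mem_image_Un:
  assumes "\<And>a. a \<in> A \<Longrightarrow> Q (f a)" and "\<And>b. b \<in> B \<Longrightarrow> \<not> Q (g b)"
  shows "{p \<in> f ` A \<union> g ` B. Q p} = f ` A"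
  using assms by auto

text \<open>\<open>graft\<close> adds edges from left to right only and keeps the two matchings
  apart. Hence the image of the right part is an admissible set, and \<open>f\<close> restricts to
  an isomorphism onto each side.\<close>

lemma cut_mem:
  assumes G: "proper_graph G" and H: "proper_graph H" and K: "proper_graph K"
    and h: "h \<in> attachments G H" and f: "f \<in> isos (graft G H h) K"
  shows "cut G H (h, f) \<in>
    (SIGMA U : admissible K. isos G (induced K (verts K - U)) \<times> isos H (induced K U))"
proof -
  note ar = G[unfolded proper_graph_def, THEN conjunct1] H[unfolded proper_graph_def, THEN conjunct1]
    K[unfolded proper_graph_def, THEN conjunct1]
  let ?L = "f \<circ> left_vertex" and ?R = "f \<circ> right_vertex"
  let ?U = "?R ` verts H"
  have iso: "is_iso f (graft G H h) K" using f by (simp add: isos_def)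
  have inj: "f x = f y \<longleftrightarrow> x = y"
    if "x \<in> verts (graft G H h)" "y \<in> verts (graft G H h)" for x y
    using iso that by (auto simp: is_iso_def bij_betw_def inj_on_eq_iff)
  have V: "verts K = ?L ` verts G \<union> ?U"
    using iso by (simp add: is_iso_def bij_betw_def image_Un image_comp)
  have disj: "?L u \<noteq> ?R v" if "u \<in> verts G" "v \<in> verts H" for u v
    using inj[of "left_vertex u" "right_vertex v"] that by (simp add: sum_encode_eq)
  have W: "verts K - ?U = ?L ` verts G" using V disj by fastforce
  have injL: "inj_on ?L (verts G)" and injR: "inj_on ?R (verts H)"
    by (auto intro!: inj_onI simp: inj sum_encode_eq)
  have edge: "(f x, f y) \<in> edges K \<longleftrightarrow> (x, y) \<in> edges (graft G H h)"
    if "x \<in> verts (graft G H h)" "y \<in> verts (graft G H h)" for x y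
    using iso that by (simp add: is_iso_def)
  have dec: "deco K (f x) = deco (graft G H h) x" if "x \<in> verts (graft G H h)" for x
    using iso that by (simp add: is_iso_def)
  have P: "pairs K = (\<lambda>p. ?L ` p) ` pairs G \<union> (\<lambda>p. ?R ` p) ` pairs H"
    using iso by (simp add: is_iso_def pairs_graft image_Un image_image image_comp)
  have pG: "p \<subseteq> verts G" "p \<noteq> {}" if "p \<in> pairs G" for p
    using that aromatic_pairs_subset[OF ar(1)] G by (auto simp: proper_graph_def)
  have pH: "p \<subseteq> verts H" "p \<noteq> {}" if "p \<in> pairs H" for p
    using that aromatic_pairs_subset[OF ar(2)] H by (auto simp: proper_graph_def)
  have split: "?L ` p \<subseteq> ?L ` verts G" "\<not> ?L ` p \<subseteq> ?U" if p: "p \<in> pairs G" for p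
  proof -
    show "?L ` p \<subseteq> ?L ` verts G" using pG[OF p] by blast
    obtain u where "u \<in> p" "u \<in> verts G" using pG[OF p] by blast
    thus "\<not> ?L ` p \<subseteq> ?U" using disj by blast
  qed
  have split': "?R ` p \<subseteq> ?U" "\<not> ?R ` p \<subseteq> ?L ` verts G" if p: "p \<in> pairs H" for p
  proof -
    show "?R ` p \<subseteq> ?U" using pH[OF p] by blast
    obtain v where "v \<in> p" "v \<in> verts H" using pH[OF p] by blast
    thus "\<not> ?R ` p \<subseteq> ?L ` verts G" using disj by (metis (no_types) image_iff subsetD)
  qed
  have isoL: "is_iso ?L G (induced K (verts K - ?U))"
    unfolding is_iso_def W
  proof (intro conjI ballI)
    show "bij_betw ?L (verts G) (verts (induced K (?L ` verts G)))"
      using injL by (simp add: bij_betw_def)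
    show "(u, v) \<in> edges G \<longleftrightarrow> (?L u, ?L v) \<in> edges (induced K (?L ` verts G))"
      if "u \<in> verts G" "v \<in> verts G" for u v
      using that by (simp add: edge)
    show "deco G v = deco (induced K (?L ` verts G)) (?L v)" if "v \<in> verts G" for v
      using that by (simp add: dec)
    \<comment> \<open>A pair coming from \<open>H\<close> is a nonempty subset of the other side, so
      the filter keeps exactly the pairs coming from \<open>G\<close>.\<close>
    have "{p \<in> pairs K. p \<subseteq> ?L ` verts G} = (\<lambda>p. ?L ` p) ` pairs G"
      unfolding P by (rule Collect_mem_image_Un) (fact split(1) split'(2))+
    thus "(\<lambda>p. ?L ` p) ` pairs G = pairs (induced K (?L ` verts G))" by simp
  qed
  have isoR: "is_iso ?R H (induced K ?U)"
    unfolding is_iso_def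
  proof (intro conjI ballI)
    show "bij_betw ?R (verts H) (verts (induced K ?U))"
      using injR by (simp add: bij_betw_def)
    show "(u, v) \<in> edges H \<longleftrightarrow> (?R u, ?R v) \<in> edges (induced K ?U)"
      if "u \<in> verts H" "v \<in> verts H" for u v
      using that by (simp add: edge)
    show "deco H v = deco (induced K ?U) (?R v)" if "v \<in> verts H" for v
      using that by (simp add: dec)
    have "{p \<in> pairs K. p \<subseteq> ?U} = (\<lambda>p. ?R ` p) ` pairs H"
      unfolding P Un_commute[of "(\<lambda>p. ?L ` p) ` pairs G"]
      by (rule Collect_mem_image_Un) (fact split'(1) split(2))+
    thus "(\<lambda>p. ?R ` p) ` pairs H = pairs (induced K ?U)" by simp
  qed
  have "?U \<in> admissible K"
    unfolding admissible_def
  proof (intro CollectI conjI ballI)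
    show "?U \<subseteq> verts K" using V by blast
    show "aromatic_graph (induced K ?U)" by (rule is_iso_aromatic[OF ar(2) isoR]) simp
    show "aromatic_graph (induced K (verts K - ?U))" by (rule is_iso_aromatic[OF ar(1) isoL]) simp
    show "case e of (u, v) \<Rightarrow> \<not> (u \<in> ?U \<and> v \<in> verts K - ?U)" if "e \<in> edges K" for e
      unfolding W using that by (auto simp: edge)
    show "p \<subseteq> ?U \<or> p \<subseteq> verts K - ?U" if "p \<in> pairs K" for p
      unfolding W using that split(1) split'(1) unfolding P by blast
  qed
  moreover have "restrict ?L (verts G) \<in> isos G (induced K (verts K - ?U))"
    using isoL is_iso_cong[OF ar(1), of "restrict ?L (verts G)" ?L] by (simp add: isos_def)
  moreover have "restrict ?R (verts H) \<in> isos H (induced K ?U)"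
    using isoR is_iso_cong[OF ar(2), of "restrict ?R (verts H)" ?R] by (simp add: isos_def)
  ultimately show ?thesis by (simp add: cut_def image_comp)
qed

text \<open>The restrictions determine \<open>f\<close> on both halves of the graft, and then
  \<open>h\<close> is determined by which images of roots are joined in \<open>K\<close> to which
  images of vertices of \<open>H\<close>.\<close>

lemma cut_inj:
  "inj_on (cut G H) (SIGMA h : attachments G H. isos (graft G H h) K)"
proof (rule inj_onI, clarify)
  fix h f k g
  assume h: "h \<in> attachments G H" and k: "k \<in> attachments G H"
    and f: "f \<in> isos (graft G H h) K" and g: "g \<in> isos (graft G H k) K"
    and eq: "cut G H (h, f) = cut G H (k, g)"
  have L: "f (left_vertex v) = g (left_vertex v)" if "v \<in> verts G" for v
    using eq that by (auto simp: cut_def fun_eq_iff restrict_def split: if_splits)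
  have R: "f (right_vertex v) = g (right_vertex v)" if "v \<in> verts H" for v
    using eq that by (auto simp: cut_def fun_eq_iff restrict_def split: if_splits)
  have fg: "f = g"
  proof (rule extensionalityI)
    \<comment> \<open>The vertex set of a graft does not depend on the attachment map, so
      \<open>f\<close> and \<open>g\<close> are extensional on the same set.\<close>
    show "f \<in> extensional (verts (graft G H h))" "g \<in> extensional (verts (graft G H h))"
      using f g by (auto simp: isos_def)
  qed (auto simp: L R)
  have edge: "h r = Some v \<longleftrightarrow> (f (left_vertex r), f (right_vertex v)) \<in> edges K"
    if "r \<in> roots G" "v \<in> verts H" "f \<in> isos (graft G H h) K" for r v h
    proof -
    have "r \<in> verts G" using that(1) by (simp add: roots_def)
    hence "(left_vertex r, right_vertex v) \<in> edges (graft G H h) \<longleftrightarrow>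
        (f (left_vertex r), f (right_vertex v)) \<in> edges K"
      using that(2,3) by (simp add: isos_def is_iso_edge[of f "graft G H h" K])
    thus ?thesis using that(1) by simp
  qed
  have "h = k"
  proof (rule extensionalityI)
    show "h \<in> extensional (roots G)" "k \<in> extensional (roots G)"
      using h k by (auto simp: attachments_def PiE_def)
    fix r assume r: "r \<in> roots G"
    \<comment> \<open>For \<open>v\<close> outside \<open>H\<close> both sides are false by
      \<open>attachments_Some\<close>; inside \<open>H\<close> both express the same edge of
      \<open>K\<close>.\<close>
    have "h r = Some v \<longleftrightarrow> k r = Some v" for v
      using edge[OF r _ f] edge[OF r _ g[folded fg]] attachments_Some(1)[OF h r, of v]
        attachments_Some(1)[OF k r, of v] by blast
    thus "h r = k r" by (metis not_None_eq)
  qed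
  thus "h = k \<and> f = g" using fg by simp
qed

text \<open>Glue \<open>f\<close> and \<open>g\<close> to \<open>k\<close> and let \<open>h\<close>
  send a root \<open>r\<close> to the vertex whose image receives the edge from \<open>f r\<close>,
  if there is one in \<open>U\<close>. Such a vertex is unique since \<open>K\<close> has
  single-valued edges and \<open>g\<close> is injective.\<close>

lemma cut_surj:
  assumes G: "proper_graph G" and H: "proper_graph H" and K: "proper_graph K"
    and U: "U \<in> admissible K"
    and f: "f \<in> isos G (induced K (verts K - U))" and g: "g \<in> isos H (induced K U)"
  obtains h k where "h \<in> attachments G H" "k \<in> isos (graft G H h) K" "cut G H (h, k) = (U, f, g)"
proof -
  note ar = G[unfolded proper_graph_def, THEN conjunct1] H[unfolded proper_graph_def, THEN conjunct1]
    K[unfolded proper_graph_def, THEN conjunct1]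
  define h where "h = (\<lambda>r\<in>roots G. if \<exists>v\<in>verts H. (f r, g v) \<in> edges K
    then Some (SOME v. v \<in> verts H \<and> (f r, g v) \<in> edges K) else None)"
  define k where "k = (\<lambda>n\<in>left_vertex ` verts G \<union> right_vertex ` verts H.
    case sum_decode n of Inl v \<Rightarrow> f v | Inr v \<Rightarrow> g v)"
  have isof: "is_iso f G (induced K (verts K - U))" and isog: "is_iso g H (induced K U)"
    using f g by (auto simp: isos_def)
  have UV: "U \<subseteq> verts K" using U by (simp add: admissible_def)
  have imf: "f ` verts G = verts K - U" and img: "g ` verts H = U"
    and injf: "inj_on f (verts G)" and injg: "inj_on g (verts H)"
    using isof isog by (auto simp: is_iso_def bij_betw_def)
  have fV: "f v \<in> verts K" "f v \<notin> U" if "v \<in> verts G" for v using imf that by auto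
  have gU: "g v \<in> U" if "v \<in> verts H" for v using img that by auto
  have sv: "single_valued (edges K)" using ar(3) by (simp add: aromatic_graph_def)
  have hS: "h r = Some v \<longleftrightarrow> (f r, g v) \<in> edges K" if r: "r \<in> roots G" and v: "v \<in> verts H" for r v
  proof
    assume "h r = Some v"
    hence ex: "\<exists>v. v \<in> verts H \<and> (f r, g v) \<in> edges K"
      and e: "v = (SOME v. v \<in> verts H \<and> (f r, g v) \<in> edges K)"
      using r by (auto simp: h_def split: if_splits)
    show "(f r, g v) \<in> edges K" using someI_ex[OF ex] e by simp
  next
    assume e: "(f r, g v) \<in> edges K"
    have "(SOME v. v \<in> verts H \<and> (f r, g v) \<in> edges K) = v"
    proof (rule some_equality)
      show "v \<in> verts H \<and> (f r, g v) \<in> edges K" using v e by simp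
      fix w assume w: "w \<in> verts H \<and> (f r, g w) \<in> edges K"
      hence "g w = g v" using sv e by (blast dest: single_valuedD)
      thus "w = v" using w v injg by (auto dest: inj_onD)
    qed
    thus "h r = Some v" using r v e by (auto simp: h_def)
  qed
  have h: "h \<in> attachments G H"
    unfolding attachments_def
  proof (rule PiE_I)
    fix r assume r: "r \<in> roots G"
    show "h r \<in> insert None (Some ` (verts H - crosses H))"
    proof (cases "h r")
      case (Some v)
      hence v: "v \<in> verts H"
        using r someI_ex[of "\<lambda>v. v \<in> verts H \<and> (f r, g v) \<in> edges K"]
          by (auto simp: h_def split: if_splits)
      hence "(f r, g v) \<in> edges K" using hS[OF r] Some by blast
      \<comment> \<open>The target of an edge of \<open>K\<close> is never a cross, which is what
        allows \<open>v\<close> as a value of an attachment map.\<close>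
      hence "deco K (g v) \<noteq> Cross" using K by (auto simp: proper_graph_def)
      moreover have "deco H v = deco K (g v)" using isog v by (simp add: is_iso_def)
      ultimately show ?thesis using v Some by (auto simp: crosses_def)
    qed simp
  qed (simp add: h_def)
  have kL: "k (left_vertex v) = f v" if "v \<in> verts G" for v using that by (simp add: k_def)
  have kR: "k (right_vertex v) = g v" if "v \<in> verts H" for v using that by (simp add: k_def)
  have "is_iso k (graft G H h) K"
    unfolding is_iso_def
  proof (intro conjI ballI)
    have "k ` verts (graft G H h) = f ` verts G \<union> g ` verts H"
      unfolding verts_graft image_Un image_image
      using kL kR by (intro arg_cong2[where f = "(\<union>)"] image_cong) auto
    hence "k ` verts (graft G H h) = verts K" using imf img UV by auto
    moreover have "inj_on k (verts (graft G H h))"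
    proof (rule inj_onI)
      fix x y
      assume x: "x \<in> verts (graft G H h)" and y: "y \<in> verts (graft G H h)" and eq: "k x = k y"
      have LR: "f u \<noteq> g v" if "u \<in> verts G" "v \<in> verts H" for u v
        using fV(2)[OF that(1)] gU[OF that(2)] by auto
      from x y eq show "x = y"
        unfolding verts_graft
        by (elim UnE imageE; hypsubst)
          (simp_all only: kL kR inj_on_eq_iff[OF injf] inj_on_eq_iff[OF injg] LR LR[symmetric])
    qed
    ultimately show "bij_betw k (verts (graft G H h)) (verts K)" by (simp add: bij_betw_def)
  next
    fix x y assume x: "x \<in> verts (graft G H h)" and y: "y \<in> verts (graft G H h)"
    have LL: "(u, v) \<in> edges G \<longleftrightarrow> (f u, f v) \<in> edges K" if "u \<in> verts G" "v \<in> verts G" for u v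
      using isof that fV by (auto simp: is_iso_def)
    have RR: "(u, v) \<in> edges H \<longleftrightarrow> (g u, g v) \<in> edges K" if "u \<in> verts H" "v \<in> verts H" for u v
      using isog that gU by (auto simp: is_iso_def)
    have RL: "(g u, f v) \<notin> edges K" if "u \<in> verts H" "v \<in> verts G" for u v
      using U gU[OF that(1)] fV[OF that(2)] by (auto simp: admissible_def)
    \<comment> \<open>A second edge from \<open>u\<close> inside \<open>G\<close> would give
      \<open>f u\<close> two outgoing edges in \<open>K\<close>, one into \<open>U\<close> and one
      outside.\<close>
    have LR: "u \<in> roots G" if "u \<in> verts G" "v \<in> verts H" "(f u, g v) \<in> edges K" for u v
      unfolding roots_def
    proof (intro CollectI conjI allI notI)
      fix w assume w: "(u, w) \<in> edges G"
      hence wG: "w \<in> verts G" using ar(1) by (auto simp: aromatic_graph_def)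
      hence "(f u, f w) \<in> edges K" using LL w that by blast
      hence "f w = g v" using sv that(3) by (blast dest: single_valuedD)
      thus False using fV(2)[OF wG] gU[OF that(2)] by simp
    qed (rule that)
    from x y show "(x, y) \<in> edges (graft G H h) \<longleftrightarrow> (k x, k y) \<in> edges K"
      unfolding verts_graft by (auto simp: kL kR LL RR RL LR hS)
  next
    fix x assume "x \<in> verts (graft G H h)"
    thus "deco (graft G H h) x = deco K (k x)"
      using isof isog unfolding verts_graft by (auto simp: is_iso_def kL kR)
  next
    have k1: "k ` left_vertex ` p = f ` p" if "p \<in> pairs G" for p
      using aromatic_pairs_subset[OF ar(1) that] kL unfolding image_image
      by (intro image_cong) auto
    have k2: "k ` right_vertex ` p = g ` p" if "p \<in> pairs H" for p
      using aromatic_pairs_subset[OF ar(2) that] kR unfolding image_image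
      by (intro image_cong) auto
    have "(\<lambda>p. k ` p) ` pairs (graft G H h) = (\<lambda>p. f ` p) ` pairs G \<union> (\<lambda>p. g ` p) ` pairs H"
      unfolding pairs_graft image_Un image_image[of _ "\<lambda>p. left_vertex ` p"]
        image_image[of _ "\<lambda>p. right_vertex ` p"]
      by (simp only: image_cong[OF refl k1] image_cong[OF refl k2])
    also have "\<dots> = {p \<in> pairs K. p \<subseteq> verts K - U} \<union> {p \<in> pairs K. p \<subseteq> U}"
      using isof isog by (simp add: is_iso_def)
    \<comment> \<open>This is where it matters that an admissible set splits no matched
      pair.\<close>
    also have "\<dots> = pairs K" using U by (auto simp: admissible_def)
    finally show "(\<lambda>p. k ` p) ` pairs (graft G H h) = pairs K" .
  qed
  hence k: "k \<in> isos (graft G H h) K" by (simp add: isos_def k_def)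
  have "k ` right_vertex ` verts H = U"
    using img kR by (simp add: image_image)
  moreover have "restrict (k \<circ> left_vertex) (verts G) = f"
  proof (rule extensionalityI)
    show "f \<in> extensional (verts G)" using f by (simp add: isos_def)
  qed (simp_all add: kL)
  moreover have "restrict (k \<circ> right_vertex) (verts H) = g"
  proof (rule extensionalityI)
    show "g \<in> extensional (verts H)" using g by (simp add: isos_def)
  qed (simp_all add: kR)
  ultimately have "cut G H (h, k) = (U, f, g)" unfolding cut_def by simp
  with h k show thesis by (rule that)
qed

lemma bij_betw_cut:
  assumes "proper_graph G" "proper_graph H" "proper_graph K"
  shows "bij_betw (cut G H) (SIGMA h : attachments G H. isos (graft G H h) K)
    (SIGMA U : admissible K. isos G (induced K (verts K - U)) \<times> isos H (induced K U))"
  unfolding bij_betw_def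
proof (intro conjI cut_inj subset_antisym subsetI)
  fix y assume "y \<in> cut G H ` (SIGMA h : attachments G H. isos (graft G H h) K)"
  thus "y \<in> (SIGMA U : admissible K. isos G (induced K (verts K - U)) \<times> isos H (induced K U))"
    using cut_mem[OF assms] by blast
next
  fix y assume "y \<in> (SIGMA U : admissible K. isos G (induced K (verts K - U)) \<times> isos H (induced K U))"
  then obtain U f g where y: "y = (U, f, g)" and *: "U \<in> admissible K"
    "f \<in> isos G (induced K (verts K - U))" "g \<in> isos H (induced K U)" by blast
  show "y \<in> cut G H ` (SIGMA h : attachments G H. isos (graft G H h) K)"
    using cut_surj[OF assms *] y by (metis (no_types, lifting) SigmaI image_eqI)
qed

lemma finite_attachments:
  assumes "aromatic_graph G" "aromatic_graph H"
  shows "finite (attachments G H)"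
  unfolding attachments_def
  using assms by (intro finite_PiE) (auto simp: aromatic_graph_def roots_def)

lemma finite_admissible: "aromatic_graph G \<Longrightarrow> finite (admissible G)"
  by (rule finite_subset[of _ "Pow (verts G)"]) (auto simp: admissible_def aromatic_graph_def)

lemma admissible_aromatic:
  assumes "U \<in> admissible G"
  shows "aromatic_graph (induced G U)" "aromatic_graph (induced G (verts G - U))"
  using assms by (simp_all add: admissible_def)

text \<open>The duality of the two structures up to symmetry factors: both sides count the triples
  consisting of a cut of \<open>K\<close> and identifications of its two parts with \<open>G\<close> and \<open>H\<close>.\<close>

lemma card_grafts_cuts:
  assumes "proper_graph G" "proper_graph H" "proper_graph K"
  shows "card {h \<in> attachments G H. iso_class (graft G H h) = iso_class K} * symmetry (iso_class K) =
    card {U \<in> admissible K. iso_class (induced K (verts K - U)) = iso_class G \<and>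
      iso_class (induced K U) = iso_class H} * (symmetry (iso_class G) * symmetry (iso_class H))"
proof -
  have ar: "aromatic_graph G" "aromatic_graph H" "aromatic_graph K"
    using assms by (simp_all add: proper_graph_def)
  have arg: "aromatic_graph (graft G H h)" if "h \<in> attachments G H" for h
    using that by (intro aromatic_graft ar)
  note fin = finite_attachments[OF ar(1,2)] finite_admissible[OF ar(3)]
  have "card (SIGMA h : attachments G H. isos (graft G H h) K) =
      (\<Sum>h\<in>attachments G H. card (isos (graft G H h) K))"
    using fin arg ar by (intro card_SigmaI) (auto intro: finite_isos)
  also have "\<dots> = (\<Sum>h\<in>attachments G H.
      if iso_class (graft G H h) = iso_class K then symmetry (iso_class K) else 0)"
    using arg ar by (intro sum.cong refl card_isos_forest) auto
  also have "\<dots> = card {h \<in> attachments G H. iso_class (graft G H h) = iso_class K} *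
      symmetry (iso_class K)"
    using fin by (simp flip: sum.inter_filter)
  finally have 1: "card (SIGMA h : attachments G H. isos (graft G H h) K) = \<dots>" .
  have "card (SIGMA U : admissible K. isos G (induced K (verts K - U)) \<times> isos H (induced K U)) =
      (\<Sum>U\<in>admissible K. card (isos G (induced K (verts K - U)) \<times> isos H (induced K U)))"
    using fin ar by (intro card_SigmaI) (auto intro!: finite_isos dest: admissible_aromatic)
  also have "\<dots> = (\<Sum>U\<in>admissible K. if iso_class (induced K (verts K - U)) = iso_class G \<and>
      iso_class (induced K U) = iso_class H
      then symmetry (iso_class G) * symmetry (iso_class H) else 0)"
    by (intro sum.cong refl)
      (auto simp: card_cartesian_product card_isos_forest ar admissible_aromatic)
  also have "\<dots> = card {U \<in> admissible K. iso_class (induced K (verts K - U)) = iso_class G \<and>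
      iso_class (induced K U) = iso_class H} * (symmetry (iso_class G) * symmetry (iso_class H))"
    using fin by (simp flip: sum.inter_filter)
  finally have 2: "card (SIGMA U : admissible K.
      isos G (induced K (verts K - U)) \<times> isos H (induced K U)) = \<dots>" .
  show ?thesis using bij_betw_same_card[OF bij_betw_cut[OF assms]] 1 2 by simp
qed

section \<open>The convolution identity\<close>

text \<open>What counting and grading require of a family of graphs. \<open>iso_closed\<close>
  carries \<open>P\<close> over to the arbitrarily chosen \<open>rep\<close>. The pair condition in
  \<open>induced_closed\<close> prevents an unmatched cross in exotic graphs; being symmetric in
  \<open>W\<close> and its complement, it serves both parts of a cut.\<close>

locale graph_class =
  fixes P :: "'c forest_graph \<Rightarrow> bool"
  assumes proper: "P G \<Longrightarrow> proper_graph G"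
    and iso_closed: "P G \<Longrightarrow> aromatic_graph H \<Longrightarrow> is_iso f G H \<Longrightarrow> P H"
    and graft_closed: "P G \<Longrightarrow> P H \<Longrightarrow> h \<in> attachments G H \<Longrightarrow> P (graft G H h)"
    and induced_closed: "P G \<Longrightarrow> W \<subseteq> verts G \<Longrightarrow> aromatic_graph (induced G W) \<Longrightarrow>
      (\<And>p. p \<in> pairs G \<Longrightarrow> p \<subseteq> W \<or> p \<subseteq> verts G - W) \<Longrightarrow> P (induced G W)"
begin

lemma aromatic: "P G \<Longrightarrow> aromatic_graph G"
  using proper by (simp add: proper_graph_def)

definition forests :: "'c forest set" where
  "forests = {G. P G} // iso_rel"

lemma iso_class_in_forests: "P G \<Longrightarrow> iso_class G \<in> forests"
  by (auto simp: forests_def iso_class_def quotient_def)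

lemma
  assumes "\<pi> \<in> forests"
  shows rep_class: "P (rep \<pi>)" and iso_class_rep: "iso_class (rep \<pi>) = \<pi>"
proof -
  obtain G where G: "P G" "\<pi> = iso_class G"
    using assms by (auto simp: forests_def iso_class_def quotient_def)
  obtain f where "is_iso f G (rep \<pi>)" using rep_iso_class_iso[OF aromatic[OF G(1)]] G(2) by blast
  thus "P (rep \<pi>)"
    using iso_closed[OF G(1)] rep_iso_class(1)[OF aromatic[OF G(1)]] G(2) by blast
  show "iso_class (rep \<pi>) = \<pi>" using rep_iso_class(2)[OF aromatic[OF G(1)]] G(2) by simp
qed

lemma aromatic_rep: "\<pi> \<in> forests \<Longrightarrow> aromatic_graph (rep \<pi>)"
  by (rule aromatic[OF rep_class])

lemma graft_in_forests:
  assumes "\<pi>\<^sub>1 \<in> forests" "\<pi>\<^sub>2 \<in> forests" "h \<in> attachments (rep \<pi>\<^sub>1) (rep \<pi>\<^sub>2)"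
  shows "iso_class (graft (rep \<pi>\<^sub>1) (rep \<pi>\<^sub>2) h) \<in> forests"
    and "num_verts (iso_class (graft (rep \<pi>\<^sub>1) (rep \<pi>\<^sub>2) h)) = num_verts \<pi>\<^sub>1 + num_verts \<pi>\<^sub>2"
proof -
  have P: "P (graft (rep \<pi>\<^sub>1) (rep \<pi>\<^sub>2) h)" using assms by (intro graft_closed rep_class)
  thus "iso_class (graft (rep \<pi>\<^sub>1) (rep \<pi>\<^sub>2) h) \<in> forests" by (rule iso_class_in_forests)
  have "finite (verts (rep \<pi>\<^sub>1))" "finite (verts (rep \<pi>\<^sub>2))"
    using assms aromatic_rep by (auto simp: aromatic_graph_def)
  hence "card (verts (graft (rep \<pi>\<^sub>1) (rep \<pi>\<^sub>2) h)) = num_verts \<pi>\<^sub>1 + num_verts \<pi>\<^sub>2"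
    unfolding verts_graft num_verts_def
    by (subst card_Un_disjoint) (auto simp: sum_encode_eq card_image inj_on_def)
  thus "num_verts (iso_class (graft (rep \<pi>\<^sub>1) (rep \<pi>\<^sub>2) h)) = num_verts \<pi>\<^sub>1 + num_verts \<pi>\<^sub>2"
    using num_verts_iso_class[OF aromatic[OF P]] by simp
qed

lemma cut_in_forests:
  assumes "\<pi> \<in> forests" "U \<in> admissible (rep \<pi>)"
  shows "iso_class (induced (rep \<pi>) (verts (rep \<pi>) - U)) \<in> forests"
    and "iso_class (induced (rep \<pi>) U) \<in> forests"
    and "num_verts (iso_class (induced (rep \<pi>) (verts (rep \<pi>) - U))) +
      num_verts (iso_class (induced (rep \<pi>) U)) = num_verts \<pi>"
proof -
  note ar = admissible_aromatic[OF assms(2)]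
  have U: "U \<subseteq> verts (rep \<pi>)" using assms(2) by (simp add: admissible_def)
  have pairs: "p \<subseteq> U \<or> p \<subseteq> verts (rep \<pi>) - U" if "p \<in> pairs (rep \<pi>)" for p
    using assms(2) that by (simp add: admissible_def)
  have "P (induced (rep \<pi>) U)"
    by (rule induced_closed[OF rep_class[OF assms(1)] U ar(1) pairs])
  thus "iso_class (induced (rep \<pi>) U) \<in> forests" by (rule iso_class_in_forests)
  have "P (induced (rep \<pi>) (verts (rep \<pi>) - U))"
    by (rule induced_closed[OF rep_class[OF assms(1)] _ ar(2)])
      (use pairs U in \<open>auto simp: double_diff\<close>)
  thus "iso_class (induced (rep \<pi>) (verts (rep \<pi>) - U)) \<in> forests" by (rule iso_class_in_forests)
  have "finite (verts (rep \<pi>))" using aromatic_rep[OF assms(1)] by (simp add: aromatic_graph_def)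
  hence "card (verts (rep \<pi>) - U) + card U = card (verts (rep \<pi>))"
    using U by (metis add.commute card_Diff_subset card_mono finite_subset le_add_diff_inverse)
  thus "num_verts (iso_class (induced (rep \<pi>) (verts (rep \<pi>) - U))) +
      num_verts (iso_class (induced (rep \<pi>) U)) = num_verts \<pi>"
    using num_verts_iso_class[OF ar(1)] num_verts_iso_class[OF ar(2)] by (simp add: num_verts_def)
qed

text \<open>Every forest with \<open>n\<close> vertices has a representative on the vertices below
  \<open>n\<close>, with finitely many choices of edges, decorations in \<open>C\<close> and pairs.
  The choices need not all satisfy \<open>P\<close>; covering the forests is enough.\<close>

lemma finite_forests:
  assumes "finite C" and deco: "\<And>G. P G \<Longrightarrow> deco G ` verts G \<subseteq> C"
  shows "finite {\<pi> \<in> forests. num_verts \<pi> = n}"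
proof (rule finite_subset)
  let ?mk = "\<lambda>(E, d, p). \<lparr>verts = {..<n}, edges = E, deco = d, pairs = p\<rparr>"
  let ?S = "Pow ({..<n} \<times> {..<n}) \<times> ({..<n} \<rightarrow>\<^sub>E C) \<times> Pow (Pow {..<n})"
  show "finite ((iso_class \<circ> ?mk) ` ?S)"
    using assms(1) by (intro finite_imageI finite_cartesian_product finite_PiE) auto
  show "{\<pi> \<in> forests. num_verts \<pi> = n} \<subseteq> (iso_class \<circ> ?mk) ` ?S"
  proof
    fix \<pi> assume "\<pi> \<in> {\<pi> \<in> forests. num_verts \<pi> = n}"
    hence \<pi>: "\<pi> \<in> forests" and n: "num_verts \<pi> = n" by auto
    let ?G = "rep \<pi>"
    note ar = aromatic_rep[OF \<pi>]
    have "finite (verts ?G)" using ar by (simp add: aromatic_graph_def)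
    then obtain f where f: "bij_betw f (verts ?G) {..<n}"
      using n by (metis atLeast0LessThan ex_bij_betw_finite_nat num_verts_def)
    hence mem: "f v < n" if "v \<in> verts ?G" for v using that by (auto simp: bij_betw_def)
    \<comment> \<open>The structure is transported along the numbering \<open>f\<close>. Decorations
      are cut off outside the vertices, where isomorphisms ignore them, to land in a finite function
      set.\<close>
    let ?E = "map_prod f f ` edges ?G"
      and ?d = "\<lambda>i\<in>{..<n}. deco ?G (inv_into (verts ?G) f i)"
      and ?p = "(\<lambda>p. f ` p) ` pairs ?G"
    let ?H = "?mk (?E, ?d, ?p)"
    have edges: "edges ?G \<subseteq> verts ?G \<times> verts ?G" using ar by (simp add: aromatic_graph_def)
    have inj: "inj_on f (verts ?G)" using f by (simp add: bij_betw_def)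
    have iso: "is_iso f ?G ?H"
      unfolding is_iso_def
    proof (intro conjI ballI)
      fix u v assume u: "u \<in> verts ?G" and v: "v \<in> verts ?G"
      show "(u, v) \<in> edges ?G \<longleftrightarrow> (f u, f v) \<in> edges ?H"
      proof
        assume "(f u, f v) \<in> edges ?H"
        then obtain u' v' where e: "(u', v') \<in> edges ?G" "f u = f u'" "f v = f v'" by auto
        hence "u = u'" "v = v'" using u v edges inj by (auto dest: inj_onD)
        thus "(u, v) \<in> edges ?G" using e by simp
      qed force
    qed (use f mem inj in \<open>auto\<close>)
    have E: "?E \<subseteq> {..<n} \<times> {..<n}" using edges mem by auto
    have arH: "aromatic_graph ?H" by (rule is_iso_aromatic[OF ar iso]) (use E in simp)
    have "restrict f (verts ?G) \<in> isos ?G ?H"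
      using iso is_iso_cong[OF ar, of "restrict f (verts ?G)" f ?H] by (simp add: isos_def)
    hence "iso_class ?H = \<pi>"
      using iso_class_eq_iff[OF ar arH] iso_class_rep[OF \<pi>] by auto
    moreover have "?d \<in> {..<n} \<rightarrow>\<^sub>E C"
    proof (rule PiE_I)
      fix i assume "i \<in> {..<n}"
      hence "inv_into (verts ?G) f i \<in> verts ?G" using f by (simp add: bij_betw_def inv_into_into)
      thus "?d i \<in> C" using deco[OF rep_class[OF \<pi>]] \<open>i \<in> {..<n}\<close> by auto
    qed simp
    moreover have "?p \<subseteq> Pow {..<n}"
      using aromatic_pairs_subset[OF ar] mem by fastforce
    ultimately show "\<pi> \<in> (iso_class \<circ> ?mk) ` ?S"
      using E by (intro image_eqI[where x = "(?E, ?d, ?p)"]) auto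
  qed
qed

end

text \<open>Turns sums over attachment maps, or over admissible sets, into sums over the resulting
  forests weighted by multiplicities.\<close>

lemma sum_over_fibres:
  fixes g :: "'b \<Rightarrow> real"
  assumes "finite S" "finite T" "f ` S \<subseteq> T"
  shows "(\<Sum>x\<in>S. g (f x)) = (\<Sum>y\<in>T. real (card {x \<in> S. f x = y}) * g y)"
proof -
  have "(\<Sum>x\<in>S. g (f x)) = (\<Sum>y\<in>T. \<Sum>x\<in>{x \<in> S. f x = y}. g (f x))"
    by (rule sum.group[OF assms, symmetric])
  also have "\<dots> = (\<Sum>y\<in>T. real (card {x \<in> S. f x = y}) * g y)"
    by (intro sum.cong refl) simp
  finally show ?thesis .
qed

text \<open>The duality in matrix form: \<open>x\<close> stands for a pair of forests,
  \<open>y\<close> for a forest, \<open>h\<close> and \<open>u\<close> for the numbers of graftings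
  and of cuts. Weighted by \<open>c\<close> and by \<open>w\<close> over \<open>s\<close> these
  agree entrywise, after which only the order of summation changes.\<close>

lemma sum_exchange_weights:
  fixes c gr w :: "'a \<Rightarrow> real" and cut s g :: "'b \<Rightarrow> real"
  assumes gr: "\<And>x. x \<in> Q \<Longrightarrow> gr x = (\<Sum>y\<in>N. h x y * g y)"
    and cut: "\<And>y. y \<in> N \<Longrightarrow> cut y = (\<Sum>x\<in>Q. u x y * w x)"
    and key: "\<And>x y. x \<in> Q \<Longrightarrow> y \<in> N \<Longrightarrow> c x * h x y = u x y * w x / s y"
  shows "(\<Sum>x\<in>Q. c x * gr x) = (\<Sum>y\<in>N. cut y / s y * g y)"
proof -
  have "(\<Sum>x\<in>Q. c x * gr x) = (\<Sum>x\<in>Q. \<Sum>y\<in>N. c x * h x y * g y)"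
    by (intro sum.cong refl) (simp add: gr sum_distrib_left mult.assoc)
  also have "\<dots> = (\<Sum>x\<in>Q. \<Sum>y\<in>N. u x y * w x / s y * g y)"
    by (intro sum.cong refl) (simp add: key)
  also have "\<dots> = (\<Sum>y\<in>N. \<Sum>x\<in>Q. u x y * w x / s y * g y)" by (rule sum.swap)
  also have "\<dots> = (\<Sum>y\<in>N. cut y / s y * g y)"
    by (intro sum.cong refl) (simp add: cut sum_divide_distrib sum_distrib_right)
  finally show ?thesis .
qed

text \<open>The theorem with operators replaced by an arbitrary real function \<open>g\<close>. Both
  sides are expanded over the target forests, and their coefficients agree by
  \<open>card_grafts_cuts\<close>.\<close>

lemma (in graph_class) convolution_identity:
  fixes \<alpha> \<beta> g :: "'c forest \<Rightarrow> real"
  assumes fin: "\<And>n. finite {\<pi> \<in> forests. num_verts \<pi> = n}"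
  shows "(\<Sum>(\<pi>\<^sub>1, \<pi>\<^sub>2) \<in> {(\<pi>\<^sub>1, \<pi>\<^sub>2) \<in> forests \<times> forests. num_verts \<pi>\<^sub>1 + num_verts \<pi>\<^sub>2 = n}.
      \<alpha> \<pi>\<^sub>1 * \<beta> \<pi>\<^sub>2 / (real (symmetry \<pi>\<^sub>1) * real (symmetry \<pi>\<^sub>2)) *
      (\<Sum>h \<in> attachments (rep \<pi>\<^sub>1) (rep \<pi>\<^sub>2). g (iso_class (graft (rep \<pi>\<^sub>1) (rep \<pi>\<^sub>2) h)))) =
    (\<Sum>\<pi> \<in> {\<pi> \<in> forests. num_verts \<pi> = n}.
      (\<Sum>U \<in> admissible (rep \<pi>). \<alpha> (iso_class (induced (rep \<pi>) (verts (rep \<pi>) - U))) *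
        \<beta> (iso_class (induced (rep \<pi>) U))) / real (symmetry \<pi>) * g \<pi>)"
    (is "(\<Sum>(\<pi>\<^sub>1, \<pi>\<^sub>2) \<in> ?Q. ?c \<pi>\<^sub>1 \<pi>\<^sub>2 * ?gr \<pi>\<^sub>1 \<pi>\<^sub>2) = (\<Sum>\<pi>\<in>?N. ?cut \<pi> / ?s \<pi> * g \<pi>)")
proof -
  let ?hc = "\<lambda>\<pi>\<^sub>1 \<pi>\<^sub>2 \<pi>. card {h \<in> attachments (rep \<pi>\<^sub>1) (rep \<pi>\<^sub>2).
    iso_class (graft (rep \<pi>\<^sub>1) (rep \<pi>\<^sub>2) h) = \<pi>}"
  let ?parts = "\<lambda>\<pi> U. (iso_class (induced (rep \<pi>) (verts (rep \<pi>) - U)), iso_class (induced (rep \<pi>) U))"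
  let ?uc = "\<lambda>\<pi>\<^sub>1 \<pi>\<^sub>2 \<pi>. card {U \<in> admissible (rep \<pi>). ?parts \<pi> U = (\<pi>\<^sub>1, \<pi>\<^sub>2)}"
  have "?Q \<subseteq> (\<Union>m\<le>n. {\<pi> \<in> forests. num_verts \<pi> = m}) \<times> (\<Union>m\<le>n. {\<pi> \<in> forests. num_verts \<pi> = m})"
    by auto
  hence finQ: "finite ?Q" by (rule finite_subset) (use fin in auto)
  have gr: "?gr \<pi>\<^sub>1 \<pi>\<^sub>2 = (\<Sum>\<pi>\<in>?N. real (?hc \<pi>\<^sub>1 \<pi>\<^sub>2 \<pi>) * g \<pi>)" if "(\<pi>\<^sub>1, \<pi>\<^sub>2) \<in> ?Q" for \<pi>\<^sub>1 \<pi>\<^sub>2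
  proof (rule sum_over_fibres[OF _ fin])
    show "finite (attachments (rep \<pi>\<^sub>1) (rep \<pi>\<^sub>2))"
      using that by (intro finite_attachments aromatic_rep) auto
    show "(\<lambda>h. iso_class (graft (rep \<pi>\<^sub>1) (rep \<pi>\<^sub>2) h)) ` attachments (rep \<pi>\<^sub>1) (rep \<pi>\<^sub>2) \<subseteq> ?N"
      using that graft_in_forests by auto
  qed
  have cut: "?cut \<pi> = (\<Sum>y\<in>?Q. real (card {U \<in> admissible (rep \<pi>). ?parts \<pi> U = y}) *
      (\<alpha> (fst y) * \<beta> (snd y)))" if "\<pi> \<in> ?N" for \<pi>
  proof -
    have "finite (admissible (rep \<pi>))"
      using that by (intro finite_admissible aromatic_rep) auto
    moreover have "?parts \<pi> ` admissible (rep \<pi>) \<subseteq> ?Q"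
      using that cut_in_forests by auto
    ultimately show ?thesis
      using sum_over_fibres[OF _ finQ, of "admissible (rep \<pi>)" "?parts \<pi>"
          "\<lambda>y. \<alpha> (fst y) * \<beta> (snd y)"] by simp
  qed
  have key: "?c \<pi>\<^sub>1 \<pi>\<^sub>2 * real (?hc \<pi>\<^sub>1 \<pi>\<^sub>2 \<pi>) = real (?uc \<pi>\<^sub>1 \<pi>\<^sub>2 \<pi>) * (\<alpha> \<pi>\<^sub>1 * \<beta> \<pi>\<^sub>2) / ?s \<pi>"
    if "(\<pi>\<^sub>1, \<pi>\<^sub>2) \<in> ?Q" "\<pi> \<in> ?N" for \<pi>\<^sub>1 \<pi>\<^sub>2 \<pi>
  proof -
    have mem: "\<pi>\<^sub>1 \<in> forests" "\<pi>\<^sub>2 \<in> forests" "\<pi> \<in> forests" using that by auto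
    have pos: "symmetry \<rho> > 0" if "\<rho> \<in> forests" for \<rho>
      using symmetry_pos[OF aromatic_rep[OF that]] iso_class_rep[OF that] by simp
    have "?hc \<pi>\<^sub>1 \<pi>\<^sub>2 \<pi> * symmetry \<pi> = ?uc \<pi>\<^sub>1 \<pi>\<^sub>2 \<pi> * (symmetry \<pi>\<^sub>1 * symmetry \<pi>\<^sub>2)"
      using card_grafts_cuts[of "rep \<pi>\<^sub>1" "rep \<pi>\<^sub>2" "rep \<pi>"] mem
      by (simp add: iso_class_rep proper rep_class)
    hence "real (?hc \<pi>\<^sub>1 \<pi>\<^sub>2 \<pi>) * ?s \<pi> = real (?uc \<pi>\<^sub>1 \<pi>\<^sub>2 \<pi>) * (?s \<pi>\<^sub>1 * ?s \<pi>\<^sub>2)"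
      by (simp only: flip: of_nat_mult)
    \<comment> \<open>Here \<open>m\<close> counts graftings, \<open>k\<close> counts cuts,
      \<open>x\<close>, \<open>y\<close>, \<open>z\<close> are the symmetry factors of the two parts
      and of the whole, and \<open>c\<close> is the product of the two functional values.\<close>
    moreover have "c / (x * y) * m = k * c / z" if "m * z = k * (x * y)" "x > 0" "y > 0" "z > 0"
      for c x y z m k :: real
    proof -
      have "c * m * z = k * c * (x * y)" using that(1) by (metis mult.assoc mult.commute)
      thus ?thesis using that(2-) by (simp add: frac_eq_eq)
    qed
    ultimately show ?thesis using pos[OF mem(1)] pos[OF mem(2)] pos[OF mem(3)]
      by (simp only: of_nat_0_less_iff)
  qed
  have "(\<Sum>y\<in>?Q. ?c (fst y) (snd y) * ?gr (fst y) (snd y)) = (\<Sum>\<pi>\<in>?N. ?cut \<pi> / ?s \<pi> * g \<pi>)"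
  proof (rule sum_exchange_weights[OF _ cut])
    fix y assume y: "y \<in> ?Q"
    obtain \<pi>\<^sub>1 \<pi>\<^sub>2 where [simp]: "y = (\<pi>\<^sub>1, \<pi>\<^sub>2)" by (rule prod.exhaust)
    show "?gr (fst y) (snd y) = (\<Sum>\<pi>\<in>?N. real (?hc (fst y) (snd y) \<pi>) * g \<pi>)"
      using gr[of \<pi>\<^sub>1 \<pi>\<^sub>2] y by simp
    show "?c (fst y) (snd y) * real (?hc (fst y) (snd y) \<pi>) =
        real (card {U \<in> admissible (rep \<pi>). ?parts \<pi> U = y}) * (\<alpha> (fst y) * \<beta> (snd y)) / ?s \<pi>"
      if "\<pi> \<in> ?N" for \<pi>
      using key[OF y[unfolded \<open>y = _\<close>] that] by (simp only: fst_conv snd_conv \<open>y = _\<close>)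
  qed
  thus ?thesis by (simp only: split_def)
qed

section \<open>Linear extensions and S-series\<close>

lemma linear_extension_superset:
  assumes "finite S" "Poly_Mapping.keys p \<subseteq> S"
  shows "linear_extension g p = (\<Sum>x\<in>S. Poly_Mapping.lookup p x *\<^sub>R g x)"
  unfolding linear_extension_def
  by (rule sum.mono_neutral_left) (use assms in \<open>auto simp: in_keys_iff\<close>)

lemma linear_extension_add:
  "linear_extension g (p + q) = linear_extension g p + linear_extension g q"
proof -
  let ?S = "Poly_Mapping.keys p \<union> Poly_Mapping.keys q"
  have "Poly_Mapping.keys (p + q) \<subseteq> ?S" by (rule keys_add)
  thus ?thesis
    by (simp add: linear_extension_superset[of ?S] lookup_add scaleR_add_left sum.distrib)
qed

lemma linear_extension_basis_vec [simp]: "linear_extension g (basis_vec x) = g x"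
  by (simp add: linear_extension_def)

lemma linear_extension_sum_basis_vec:
  "linear_extension g (\<Sum>i\<in>I. basis_vec (k i)) = (\<Sum>i\<in>I. g (k i))"
  by (induction I rule: infinite_finite_induct)
    (simp_all add: linear_extension_add, simp_all add: linear_extension_def)

lemma convolution_basis_vec:
  "(a \<star> b) (basis_vec \<pi>) =
    (\<Sum>U \<in> admissible (rep \<pi>). a (basis_vec (iso_class (induced (rep \<pi>) (verts (rep \<pi>) - U)))) *
      b (basis_vec (iso_class (induced (rep \<pi>) U))))"
  by (simp add: convolution_def connes_kreimer_def tensor_mult_def ck_forest_def
      linear_extension_sum_basis_vec)

lemma free_space_sum: "(\<And>i. i \<in> I \<Longrightarrow> p i \<in> free_space A) \<Longrightarrow> (\<Sum>i\<in>I. p i) \<in> free_space A"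
proof (induction I rule: infinite_finite_induct)
  case (insert i I)
  hence "p i \<in> free_space A" "(\<Sum>i\<in>I. p i) \<in> free_space A" by auto
  thus ?case using insert.hyps keys_add[of "p i" "\<Sum>i\<in>I. p i"] by (auto simp: free_space_def)
qed (auto simp: free_space_def)

lemma linear_functional_on_sum:
  assumes L: "linear_functional_on (free_space A) L" and "\<And>i. i \<in> I \<Longrightarrow> p i \<in> free_space A"
  shows "L (\<Sum>i\<in>I. p i) = (\<Sum>i\<in>I. L (p i))"
proof -
  \<comment> \<open>The value at 0 settles the empty sum and sums over infinite index sets, which
    are 0 by convention.\<close>
  have "0 \<in> free_space A" by (simp add: free_space_def)
  hence "L (0 *\<^sub>R 0) = 0 * L 0" using L unfolding linear_functional_on_def by blast
  hence zero: "L 0 = 0" by simp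
  show ?thesis
    using assms(2)
  proof (induction I rule: infinite_finite_induct)
    case (insert i I)
    have "p i \<in> free_space A" "(\<Sum>i\<in>I. p i) \<in> free_space A"
      using insert.prems by (auto intro: free_space_sum)
    hence "L (p i + (\<Sum>i\<in>I. p i)) = L (p i) + L (\<Sum>i\<in>I. p i)"
      using L unfolding linear_functional_on_def by blast
    thus ?case using insert by simp
  qed (simp_all add: zero)
qed

lemma basis_vec_in_free_space: "\<pi> \<in> A \<Longrightarrow> basis_vec \<pi> \<in> free_space A"
  by (simp add: free_space_def)

text \<open>At a fixed point \<open>x\<close> this is \<open>convolution_identity\<close> with
  \<open>g\<close> the value of the operator of a forest at \<open>\<phi>\<close> and
  \<open>x\<close>. The larger set \<open>A\<close> carries the assumptions on \<open>F\<close>,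
  while the series run over a subfamily whose levels are finite.\<close>

lemma (in graph_class) S_series_comp_forests:
  fixes F :: "('c, 'd::finite) forest_operator"
  assumes fin: "\<And>n. finite {\<pi> \<in> forests. num_verts \<pi> = n}"
    and sub: "forests \<subseteq> A"
    and lin: "linear_to_operators A F" and mult: "multiplicative A F" and \<phi>: "smooth \<phi>"
  shows "S_series_comp F forests a b \<phi> = S_series F forests (a \<star> b) \<phi>"
proof (intro ext)
  fix n x
  have F: "F (basis_vec \<pi>\<^sub>1) (F (basis_vec \<pi>\<^sub>2) \<phi>) x =
      (\<Sum>h \<in> attachments (rep \<pi>\<^sub>1) (rep \<pi>\<^sub>2).
        F (basis_vec (iso_class (graft (rep \<pi>\<^sub>1) (rep \<pi>\<^sub>2) h))) \<phi> x)"
    if \<pi>: "\<pi>\<^sub>1 \<in> forests" "\<pi>\<^sub>2 \<in> forests" for \<pi>\<^sub>1 \<pi>\<^sub>2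
  proof -
    have "F (basis_vec \<pi>\<^sub>1) (F (basis_vec \<pi>\<^sub>2) \<phi>) = F (basis_vec \<pi>\<^sub>1 \<diamondop> basis_vec \<pi>\<^sub>2) \<phi>"
      using mult \<phi> basis_vec_in_free_space \<pi> sub unfolding multiplicative_def by (metis subsetD)
    moreover have "linear_functional_on (free_space A) (\<lambda>p. F p \<phi> x)"
      using lin \<phi> by (simp add: linear_to_operators_def)
    moreover have "basis_vec (iso_class (graft (rep \<pi>\<^sub>1) (rep \<pi>\<^sub>2) h)) \<in> free_space A"
      if "h \<in> attachments (rep \<pi>\<^sub>1) (rep \<pi>\<^sub>2)" for h
      using graft_in_forests(1)[OF \<pi> that] sub by (intro basis_vec_in_free_space) auto
    ultimately show ?thesis
      using linear_functional_on_sum[of A "\<lambda>p. F p \<phi> x" "attachments (rep \<pi>\<^sub>1) (rep \<pi>\<^sub>2)"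
          "\<lambda>h. basis_vec (iso_class (graft (rep \<pi>\<^sub>1) (rep \<pi>\<^sub>2) h))"]
      by (simp add: grossman_larson_def gl_forests_def)
  qed
  show "S_series_comp F forests a b \<phi> n x = S_series F forests (a \<star> b) \<phi> n x"
    unfolding S_series_comp_def S_series_def convolution_basis_vec
    by (subst convolution_identity[OF fin, symmetric]) (auto intro!: sum.cong simp: F)
qed

section \<open>The three families of forests\<close>

lemma is_iso_deco_image:
  assumes "is_iso f G H"
  shows "deco H ` verts H = deco G ` verts G"
proof -
  have "verts H = f ` verts G" using assms by (simp add: is_iso_def bij_betw_def)
  thus ?thesis using assms by (simp add: is_iso_def image_image)
qed

lemma graph_class_decorated: "graph_class (decorated_graph D)"
proof
  fix G H :: "'a forest_graph" and f h W
  assume G: "decorated_graph D G"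
  \<comment> \<open>Vertices labelled by \<open>Dec\<close> are never crosses, and edges end at
    vertices.\<close>
  show "proper_graph G"
    using G by (fastforce simp: decorated_graph_def proper_graph_def aromatic_graph_def)
  show "decorated_graph D H" if "aromatic_graph H" "is_iso f G H"
    using G that is_iso_deco_image[OF that(2)] by (simp add: decorated_graph_def is_iso_def)
  show "decorated_graph D (graft G H h)" if "decorated_graph D H" "h \<in> attachments G H"
    using G that by (auto simp: decorated_graph_def pairs_graft intro: aromatic_graft)
  show "decorated_graph D (induced G W)" if "W \<subseteq> verts G" "aromatic_graph (induced G W)"
    using G that by (auto simp: decorated_graph_def)
qed

lemma cross_graph_iso:
  assumes "cross_graph G" "aromatic_graph H" "is_iso f G H"
  shows "cross_graph H"
proof -
  have "deco H v \<noteq> Cross" if "(u, v) \<in> edges H" for u v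
  proof -
    have "u \<in> verts H" "v \<in> verts H" using that assms(2) by (auto simp: aromatic_graph_def)
    moreover have "verts H = f ` verts G" using assms(3) by (simp add: is_iso_def bij_betw_def)
    ultimately obtain u' v' where *: "u' \<in> verts G" "v' \<in> verts G" "u = f u'" "v = f v'" by blast
    hence "(u', v') \<in> edges G" using that assms(3) by (simp add: is_iso_def)
    hence "deco G v' \<noteq> Cross" using assms(1) by (auto simp: cross_graph_def)
    thus ?thesis using * assms(3) by (simp add: is_iso_def)
  qed
  thus ?thesis
    using assms is_iso_deco_image[OF assms(3)] by (auto simp: cross_graph_def)
qed

text \<open>An edge into a cross could only be a new one, and \<open>attachments\<close> has no
  crosses among its values.\<close>

lemma cross_graph_graft:
  assumes "cross_graph G" "cross_graph H" "h \<in> attachments G H"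
  shows "cross_graph (graft G H h)"
proof -
  have "deco (graft G H h) y \<noteq> Cross" if "(x, y) \<in> edges (graft G H h)" for x y
    using that by (cases rule: edges_graft_cases)
      (use assms attachments_Some(2)[OF assms(3)] in \<open>auto simp: cross_graph_def\<close>)
  thus ?thesis using assms by (auto simp: cross_graph_def intro: aromatic_graft)
qed

lemma cross_graph_induced:
  "cross_graph G \<Longrightarrow> W \<subseteq> verts G \<Longrightarrow> aromatic_graph (induced G W) \<Longrightarrow> cross_graph (induced G W)"
  by (auto simp: cross_graph_def)

lemma graph_class_grafted: "graph_class grafted_graph"
proof
  fix G H :: "'a forest_graph" and f h W
  assume G: "grafted_graph G"
  show "proper_graph G" using G by (auto simp: grafted_graph_def cross_graph_def proper_graph_def)
  show "grafted_graph H" if "aromatic_graph H" "is_iso f G H"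
    using G that(1) cross_graph_iso[OF _ that] that(2)
    by (simp add: grafted_graph_def) (simp add: is_iso_def)
  show "grafted_graph (graft G H h)" if "grafted_graph H" "h \<in> attachments G H"
    using G that by (simp add: grafted_graph_def cross_graph_graft pairs_graft)
  show "grafted_graph (induced G W)" if "W \<subseteq> verts G" "aromatic_graph (induced G W)"
    using G that by (simp add: grafted_graph_def cross_graph_induced)
qed

section \<open>Exotic forests: perfect matchings as partitions of the crosses into pairs\<close>

lemma partition_on_image:
  assumes P: "partition_on A P" and f: "inj_on f A"
  shows "partition_on (f ` A) ((\<lambda>p. f ` p) ` P)"
proof -
  have "{} \<notin> (\<lambda>p. f ` p) ` P" using partition_onD3[OF P] by auto
  thus ?thesis using partition_on_inj_image[OF P f] by simp
qed

lemma partition_on_Un: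
  assumes "partition_on A P" "partition_on B Q" "A \<inter> B = {}"
  shows "partition_on (A \<union> B) (P \<union> Q)"
proof -
  have "disjoint (P \<union> Q)"
    using assms by (intro disjoint_union) (auto simp: partition_on_def)
  thus ?thesis using assms(1,2) by (auto simp: partition_on_def)
qed

lemma graph_class_exotic: "graph_class exotic_graph"
proof
  fix G H :: "'a forest_graph" and f h W
  assume G: "exotic_graph G"
  show "proper_graph G"
    using G by (auto simp: exotic_graph_def cross_graph_def proper_graph_def partition_on_def)
  show "exotic_graph H" if H: "aromatic_graph H" "is_iso f G H"
  proof -
    have cr: "crosses H = f ` crosses G"
    proof -
      have "verts H = f ` verts G" using H(2) by (simp add: is_iso_def bij_betw_def)
      thus ?thesis using H(2) by (auto simp: crosses_def is_iso_def)
    qed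
    have inj: "inj_on f (crosses G)"
      using H(2) by (auto simp: crosses_def is_iso_def bij_betw_def intro: inj_on_subset)
    have part: "partition_on (crosses G) (pairs G)" using G by (simp add: exotic_graph_def)
    have P: "pairs H = (\<lambda>p. f ` p) ` pairs G" using H(2) by (simp add: is_iso_def)
    have "card (f ` p) = 2" if "p \<in> pairs G" for p
    proof -
      have "p \<subseteq> crosses G" using part that by (auto simp: partition_on_def)
      hence "card (f ` p) = card p" using inj by (intro card_image) (rule inj_on_subset)
      thus ?thesis using G that by (simp add: exotic_graph_def)
    qed
    moreover have "partition_on (crosses H) (pairs H)"
      unfolding cr P by (rule partition_on_image[OF part inj])
    ultimately show ?thesis
      using G cross_graph_iso[OF _ H] P by (auto simp: exotic_graph_def)
  qed
  show "exotic_graph (graft G H h)" if H: "exotic_graph H" "h \<in> attachments G H"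
  proof -
    have "crosses (graft G H h) = left_vertex ` crosses G \<union> right_vertex ` crosses H"
      by (auto simp: crosses_def)
    moreover have "card (left_vertex ` p) = card p" "card (right_vertex ` p) = card p" for p
      by (simp_all add: card_image inj_on_def sum_encode_eq)
    moreover have "partition_on (left_vertex ` crosses G \<union> right_vertex ` crosses H)
        (pairs (graft G H h))"
      unfolding pairs_graft
    proof (rule partition_on_Un)
      show "partition_on (left_vertex ` crosses G) ((\<lambda>p. left_vertex ` p) ` pairs G)"
        by (rule partition_on_image)
          (use G in \<open>auto simp: exotic_graph_def inj_on_def sum_encode_eq\<close>)
      show "partition_on (right_vertex ` crosses H) ((\<lambda>p. right_vertex ` p) ` pairs H)"
        by (rule partition_on_image)
          (use H(1) in \<open>auto simp: exotic_graph_def inj_on_def sum_encode_eq\<close>)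
      show "left_vertex ` crosses G \<inter> right_vertex ` crosses H = {}"
        by (auto simp: sum_encode_eq)
    qed
    ultimately show ?thesis
      using G H cross_graph_graft by (auto simp: exotic_graph_def pairs_graft)
  qed
  show "exotic_graph (induced G W)"
    if W: "W \<subseteq> verts G" "aromatic_graph (induced G W)"
      and split: "\<And>p. p \<in> pairs G \<Longrightarrow> p \<subseteq> W \<or> p \<subseteq> verts G - W"
  proof -
    have part: "partition_on (crosses G) (pairs G)" using G by (simp add: exotic_graph_def)
    have cr: "crosses (induced G W) = crosses G \<inter> W" using W(1) by (auto simp: crosses_def)
    have "partition_on (crosses G \<inter> W) {p \<in> pairs G. p \<subseteq> W}"
      unfolding partition_on_def
    proof (intro conjI)
      \<comment> \<open>A cross in \<open>W\<close> lies in some pair, and that pair, not being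
        split, lies in \<open>W\<close> as a whole.\<close>
      show "\<Union> {p \<in> pairs G. p \<subseteq> W} = crosses G \<inter> W"
        using partition_onD1[OF part] split by blast
      show "disjoint {p \<in> pairs G. p \<subseteq> W}"
        by (rule pairwise_subset[OF partition_onD2[OF part]]) blast
      show "{} \<notin> {p \<in> pairs G. p \<subseteq> W}" using partition_onD3[OF part] by simp
    qed
    thus ?thesis
      using G W cr cross_graph_induced by (auto simp: exotic_graph_def)
  qed
qed

text \<open>Grafting and cutting create no new labels. This makes the whole development available
  for forests with labels in a finite \<open>C\<close>, even when \<open>D\<close> is
  infinite.\<close>

lemma graph_class_with_decorations:
  assumes "graph_class P"
  shows "graph_class (\<lambda>G. P G \<and> deco G ` verts G \<subseteq> C)"
proof -
  interpret graph_class P by (rule assms)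
  show ?thesis
  proof
    fix G H :: "'a forest_graph" and f h W
    assume G: "P G \<and> deco G ` verts G \<subseteq> C"
    show "proper_graph G" using G proper by blast
    show "P H \<and> deco H ` verts H \<subseteq> C" if "aromatic_graph H" "is_iso f G H"
      using G that iso_closed[of G H f] is_iso_deco_image[of f G H] by simp
    show "P (graft G H h) \<and> deco (graft G H h) ` verts (graft G H h) \<subseteq> C"
      if "P H \<and> deco H ` verts H \<subseteq> C" "h \<in> attachments G H"
      using G that graft_closed[of G H h] by auto
    show "P (induced G W) \<and> deco (induced G W) ` verts (induced G W) \<subseteq> C"
      if "W \<subseteq> verts G" "aromatic_graph (induced G W)"
        "\<And>p. p \<in> pairs G \<Longrightarrow> p \<subseteq> W \<or> p \<subseteq> verts G - W"
      using G that induced_closed[of G W] by (simp, blast)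
  qed
qed

text \<open>\<open>with_decorations\<close> inspects the chosen representative only, but the set of
  labels is invariant under isomorphism.\<close>

lemma with_decorations_quotient:
  assumes "graph_class P"
  shows "with_decorations C ({G. P G} // iso_rel) = {G. P G \<and> deco G ` verts G \<subseteq> C} // iso_rel"
proof -
  interpret P: graph_class P by (rule assms)
  interpret PC: graph_class "\<lambda>G. P G \<and> deco G ` verts G \<subseteq> C"
    by (rule graph_class_with_decorations) (rule assms)
  have "with_decorations C P.forests = PC.forests"
  proof (intro subset_antisym subsetI)
    fix \<pi> assume \<pi>: "\<pi> \<in> with_decorations C P.forests"
    hence "P (rep \<pi>) \<and> deco (rep \<pi>) ` verts (rep \<pi>) \<subseteq> C" and "\<pi> \<in> P.forests"
      using P.rep_class by (auto simp: with_decorations_def)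
    thus "\<pi> \<in> PC.forests" using PC.iso_class_in_forests P.iso_class_rep by fastforce
  next
    fix \<pi> assume \<pi>: "\<pi> \<in> PC.forests"
    have "P (rep \<pi>)" "deco (rep \<pi>) ` verts (rep \<pi>) \<subseteq> C" using PC.rep_class[OF \<pi>] by auto
    thus "\<pi> \<in> with_decorations C P.forests"
      using P.iso_class_in_forests PC.iso_class_rep[OF \<pi>] by (fastforce simp: with_decorations_def)
  qed
  thus ?thesis by (simp add: P.forests_def PC.forests_def)
qed

lemma S_series_comp_with_decorations:
  fixes F :: "('c, 'd::finite) forest_operator"
  assumes P: "graph_class P" and A: "A = {G. P G} // iso_rel" and "finite C"
    and F: "linear_to_operators A F" "multiplicative A F" "smooth \<phi>"
  shows "S_series_comp F (with_decorations C A) a b \<phi> = S_series F (with_decorations C A) (a \<star> b) \<phi>"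
proof -
  interpret PC: graph_class "\<lambda>G. P G \<and> deco G ` verts G \<subseteq> C"
    by (rule graph_class_with_decorations) (rule P)
  have eq: "PC.forests = with_decorations C A"
    by (simp add: PC.forests_def A with_decorations_quotient[OF P])
  hence "PC.forests \<subseteq> A" by (auto simp: with_decorations_def)
  moreover have "finite {\<pi> \<in> PC.forests. num_verts \<pi> = n}" for n
    by (rule PC.finite_forests[OF \<open>finite C\<close>]) simp
  ultimately have "S_series_comp F PC.forests a b \<phi> = S_series F PC.forests (a \<star> b) \<phi>"
    using PC.S_series_comp_forests F by blast
  thus ?thesis by (simp only: eq)
qed

lemma with_decorations_all:
  assumes "graph_class P" "A = {G. P G} // iso_rel" "\<And>G. P G \<Longrightarrow> deco G ` verts G \<subseteq> C"
  shows "with_decorations C A = A"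
proof -
  have "{G. P G \<and> deco G ` verts G \<subseteq> C} = {G. P G}" using assms(3) by blast
  thus ?thesis using with_decorations_quotient[OF assms(1)] assms(2) by simp
qed

theorem theorem4p2:
  fixes D :: "'c set"
    and A :: "'c forest set"
    and F :: "('c, 'd::finite) forest_operator"
    and a b :: "('c forest \<Rightarrow>\<^sub>0 real) \<Rightarrow> real"
    and \<phi> :: "real ^ 'd \<Rightarrow> real"
  assumes "A = decorated_forests D \<or> A = grafted_forests \<or> A = exotic_forests"
    and "linear_to_operators A F"
    and "multiplicative A F"
    and "linear_functional_on (free_space A) a"
    and "linear_functional_on (free_space A) b"
    and "test_function \<phi>"
  shows "(finite D \<longrightarrow> S_series_comp F A a b \<phi> = S_series F A (a \<star> b) \<phi>) \<and>
    (\<forall>C. finite C \<longrightarrow>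
       S_series_comp F (with_decorations C A) a b \<phi> = S_series F (with_decorations C A) (a \<star> b) \<phi>)"
proof -
  \<comment> \<open>\<open>C\<close> contains all labels that can occur. It is finite for grafted
    and exotic forests, and for decorated ones as soon as \<open>D\<close> is.\<close>
  have "\<exists>P C. graph_class P \<and> A = {G. P G} // iso_rel \<and>
      (\<forall>G. P G \<longrightarrow> deco G ` verts G \<subseteq> C) \<and> (finite D \<longrightarrow> finite C)"
    using assms(1)
  proof (elim disjE)
    assume "A = decorated_forests D"
    thus ?thesis
      by (intro exI[of _ "decorated_graph D"] exI[of _ "Dec ` D"])
        (simp add: graph_class_decorated decorated_forests_def decorated_graph_def)
  next
    assume "A = grafted_forests"
    thus ?thesis
      by (intro exI[of _ grafted_graph] exI[of _ "{Bullet, Cross}"])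
        (simp add: graph_class_grafted grafted_forests_def grafted_graph_def cross_graph_def)
  next
    assume "A = exotic_forests"
    thus ?thesis
      by (intro exI[of _ exotic_graph] exI[of _ "{Bullet, Cross}"])
        (simp add: graph_class_exotic exotic_forests_def exotic_graph_def cross_graph_def)
  qed
  then obtain P C where P: "graph_class P" "A = {G. P G} // iso_rel"
    and C: "\<And>G. P G \<Longrightarrow> deco G ` verts G \<subseteq> C" "finite D \<Longrightarrow> finite C" by blast
  have "smooth \<phi>" using assms(6) by (simp add: test_function_def)
  note S = S_series_comp_with_decorations[OF P _ assms(2,3) this]
  \<comment> \<open>The unrestricted identity is the restricted one for this \<open>C\<close>, since
    restricting to all possible labels leaves \<open>A\<close> unchanged.\<close>
  show ?thesis
    using S[OF C(2)] S with_decorations_all[OF P C(1)] by simp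
qed

end
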